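(* Let $m\geq2$ and let $$H(U_1,\ldots,U_n):=\sum_{k=1}^{m-1}\sum_{|\alpha|=k}\overline{a}_\alpha U_\alpha^*+a_0I+\sum_{k=1}^{m-1}\sum_{|\alpha|=k}a_\alpha U_\alpha,\quad a_\alpha\in\mathbb{C},$$ be a selfadjoint element of the reduced group $C^*$-algebra $C^*_{\mathrm{red}}(\mathbb{F}_n)$ with $\|H(U_1,\ldots,U_n)\|\leq1$. Then the following statements hold. (i) $\left(\sum_{|\alpha|=k}|a_\alpha|^2\right)^{1/2}\leq(1-|a_0|)\cos\frac{\pi}{\left[\frac{m-1}{k}\right]+2}$ for $1\leq k\leq m-1$. (ii) $\sum_{k=0}^{m-1}\left\|\sum_{|\alpha|=k}|a_\alpha|T_\alpha\right\|\leq1$ for any $[T_1,\ldots,T_n]\in[B(\mathcal{H})^n]_{\gamma_m}$, where $\gamma_m\in(0,1]$ is the solution of the equation $\sum_{k=1}^{m-1}t^k\cos\frac{\pi}{\left[\frac{m-1}{k}\right]+2}=1$. Moreover, $\{\gamma_m\}$ is a strictly decreasing sequence which converges to $\frac12$. (iii) $\sum_{k=1}^{m-1}\left\|\sum_{|\alpha|=k}|\overline{a}_\alpha|T_\alpha^*\right\|+|a_0|+\sum_{k=1}^{m-1}\left\|\sum_{|\alpha|=k}|a_\alpha|T_\alpha\right\|\leq1$ for any $[T_1,\ldots,T_n]\in[B(\mathcal{H})^n]_{t_m}$, where $t_m\in(0,1]$ is the solution of the equation $\sum_{k=1}^{m-1}t^k\cos\frac{\pi}{\left[\frac{m-1}{k}\right]+2}=\frac12$.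 Moreover, $\{t_m\}$ is a strictly decreasing sequence which converges to $\frac13$. In particular, if $r_1,\ldots,r_n\geq0$, then (iv) $\sum_{k=0}^{m-1}\left(\sum_{|\alpha|=k}|a_\alpha|r_\alpha\right)\leq1$ if $\|(r_1,\ldots,r_n)\|_2\leq\gamma_m$; (v) $|a_0|+2\sum_{k=1}^{m-1}\left(\sum_{|\alpha|=k}|a_\alpha|r_\alpha\right)\leq1$ if $\|(r_1,\ldots,r_n)\|_2\leq t_m$.
   Context: $\mathbb{F}_n$ is the free group with generators $g_1,\dots,g_n$, and $\ell^2(\mathbb{F}_n)$ has canonical basis $\{\xi_\sigma\}_{\sigma\in\mathbb{F}_n}$. The unitary operators $U_i$ on $\ell^2(\mathbb{F}_n)$ are determined by $U_i\xi_\sigma=\xi_{g_i\sigma}$, $i=1,\dots,n$; $C^*_{\mathrm{red}}(\mathbb{F}_n)$ is the $C^*$-algebra generated by $U_1,\dots,U_n$. $\mathbb{F}_n^+$ is the unital free semigroup on $g_1,\dots,g_n$ with identity $g_0$; $|g_{i_1}\cdots g_{i_k}|=k$, $|g_0|=0$; sums are over $\alpha\in\mathbb{F}_n^+$. For $\alpha=g_{i_1}\cdots g_{i_k}$, $T_\alpha:=T_{i_1}\cdots T_{i_k}$, and $T_{g_0}:=I$ (similarly $U_\alpha$, and $r_\alpha$ for scalars); $T_\alpha^*:=(T_\alpha)^*$; $a_0:=a_{g_0}$. $\mathcal{H}$ is a Hilbert space, $B(\mathcal{H})$ is the algebra of bounded operators on it, and $[B(\mathcal{H})^n]_r:=\{(T_1,\ldots,T_n)\in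 B(\mathcal{H})^n:\|T_1T_1^*+\cdots+T_nT_n^*\|^{1/2}\le r\}$. $[x]$ is the integer part of $x$; $\|\cdot\|_2$ is the Euclidean norm.
   Formalization: For m=2 the equation for γ_m reads t/2=1, whose only solution 2 is not in (0,1]; so γ_m is taken as the unique positive solution for all m≥2, and γ_m≤1 is claimed only for m≥3. *)

theory Defs
  imports "HOL-Analysis.Analysis"
begin

section \<open>Complex Hilbert spaces\<close>

text \<open>
  The inner product is linear in its first argument. The axiom \<open>cinner_self\<close> makes the given norm
  the one induced by the inner product; definiteness follows from it.
\<close>

class complex_inner = real_normed_vector +
  fixes scaleC :: "complex \<Rightarrow> 'a \<Rightarrow> 'a"  (infixr "*\<^sub>C" 75)
    and cinner :: "'a \<Rightarrow> 'a \<Rightarrow> complex"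
  assumes scaleC_add_right: "c *\<^sub>C (x + y) = c *\<^sub>C x + c *\<^sub>C y"
    and scaleC_add_left: "(c + d) *\<^sub>C x = c *\<^sub>C x + d *\<^sub>C x"
    and scaleC_scaleC: "c *\<^sub>C d *\<^sub>C x = (c * d) *\<^sub>C x"
    and scaleC_of_real: "complex_of_real r *\<^sub>C x = r *\<^sub>R x"
    and cinner_commute: "cinner x y = cnj (cinner y x)"
    and cinner_add_left: "cinner (x + y) z = cinner x z + cinner y z"
    and cinner_scaleC_left: "cinner (c *\<^sub>C x) y = c * cinner x y"
    and cinner_self: "cinner x x = complex_of_real ((norm x)\<^sup>2)"

class chilbert_space = complex_inner + complete_space

lemma scaleC_one [simp]: "1 *\<^sub>C (x::'a::complex_inner) = x"
  using scaleC_of_real[of 1 x] by simp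

lemma cinner_add_right:
  fixes x y z :: "'a::complex_inner"
  shows "cinner x (y + z) = cinner x y + cinner x z"
  by (metis cinner_add_left cinner_commute complex_cnj_add)

lemma cinner_diff_right:
  fixes x y z :: "'a::complex_inner"
  shows "cinner x (y - z) = cinner x y - cinner x z"
  by (metis add_diff_cancel_right' cinner_add_right diff_add_cancel)

lemma cinner_eqI:
  fixes y z :: "'a::complex_inner"
  assumes "\<And>x. cinner x y = cinner x z"
  shows "y = z"
proof -
  have "cinner (y - z) (y - z) = 0"
    by (simp add: cinner_diff_right assms)
  then show ?thesis
    by (simp add: cinner_self)
qed

section \<open>Bounded operators\<close>

text \<open>
  Operators are functions, and their norm is the library's \<open>onorm\<close>.
\<close>

definition bounded_operators :: "('a::complex_inner \<Rightarrow> 'a) set" where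
  "bounded_operators = {f. bounded_linear f \<and> (\<forall>c x. f (c *\<^sub>C x) = c *\<^sub>C f x)}"

definition cadjoint :: "('a::complex_inner \<Rightarrow> 'a) \<Rightarrow> 'a \<Rightarrow> 'a" where
  "cadjoint f = (THE g. \<forall>x y. cinner (f x) y = cinner x (g y))"

lemma cadjoint_eqI:
  assumes "\<And>x y. cinner (f x) y = cinner x (g y)"
  shows "cadjoint f = g"
  unfolding cadjoint_def
proof (rule the_equality)
  fix h assume h: "\<forall>x y. cinner (f x) y = cinner x (h y)"
  show "h = g"
  proof
    fix y show "h y = g y"
      by (rule cinner_eqI) (metis assms h)
  qed
qed (use assms in blast)

text \<open>The \<open>C\<^sup>*\<close>-algebra of operators generated by a set \<open>S\<close> of bounded operators.\<close>

inductive_set cstar_generated :: "('a::complex_inner \<Rightarrow> 'a) set \<Rightarrow> ('a \<Rightarrow> 'a) set"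
  for S :: "('a \<Rightarrow> 'a) set" where
  gen: "f \<in> S \<Longrightarrow> f \<in> cstar_generated S"
| add: "f \<in> cstar_generated S \<Longrightarrow> g \<in> cstar_generated S \<Longrightarrow> (\<lambda>x. f x + g x) \<in> cstar_generated S"
| scale: "f \<in> cstar_generated S \<Longrightarrow> (\<lambda>x. c *\<^sub>C f x) \<in> cstar_generated S"
| comp: "f \<in> cstar_generated S \<Longrightarrow> g \<in> cstar_generated S \<Longrightarrow> f \<circ> g \<in> cstar_generated S"
| adj: "f \<in> cstar_generated S \<Longrightarrow> cadjoint f \<in> cstar_generated S"
| lim: "(\<And>k::nat. F k \<in> cstar_generated S) \<Longrightarrow> f \<in> bounded_operators \<Longrightarrow>
    (\<lambda>k. onorm (\<lambda>x. F k x - f x)) \<longlonglongrightarrow> 0 \<Longrightarrow> f \<in> cstar_generated S"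

section \<open>Words and operator monomials\<close>

text \<open>
  The generators are indexed by a finite type \<open>'n\<close>, so that \<open>n = CARD('n)\<close>. The free
  semigroup is the type \<open>'n list\<close>, with identity \<open>[]\<close> and \<open>|\<alpha>| = length \<alpha>\<close>.
\<close>

primrec op_word :: "('n \<Rightarrow> 'a \<Rightarrow> 'a) \<Rightarrow> 'n list \<Rightarrow> 'a \<Rightarrow> 'a" where
  "op_word T [] = id"
| "op_word T (i # \<alpha>) = T i \<circ> op_word T \<alpha>"

definition scalar_word :: "('n \<Rightarrow> 'b::comm_monoid_mult) \<Rightarrow> 'n list \<Rightarrow> 'b" where
  "scalar_word r \<alpha> = prod_list (map r \<alpha>)"

text \<open>\<open>\<Sum>\<^bsub>|\<alpha>|=k\<^esub> c\<^sub>\<alpha> V\<^sub>\<alpha>\<close> for a family of operators \<open>V\<close>.\<close>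

definition homogeneous_sum ::
    "nat \<Rightarrow> ('n::finite list \<Rightarrow> complex) \<Rightarrow> ('n list \<Rightarrow> 'a \<Rightarrow> 'a) \<Rightarrow> 'a::complex_inner \<Rightarrow> 'a" where
  "homogeneous_sum k c V = (\<lambda>x. \<Sum>\<alpha> | length \<alpha> = k. c \<alpha> *\<^sub>C V \<alpha> x)"

text \<open>The closed ball \<open>[B(\<H>)\<^sup>n]\<^sub>r\<close>.\<close>

definition row_ball :: "real \<Rightarrow> ('n::finite \<Rightarrow> 'a::complex_inner \<Rightarrow> 'a) set" where
  "row_ball r = {T. (\<forall>i. T i \<in> bounded_operators) \<and>
     sqrt (onorm (\<lambda>x. \<Sum>i\<in>UNIV. T i (cadjoint (T i) x))) \<le> r}"

section \<open>The free group\<close>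

text \<open>
  Elements are reduced words in the letters \<open>(True, i)\<close>, standing for \<open>g\<^sub>i\<close>, and \<open>(False, i)\<close>,
  standing for \<open>g\<^sub>i\<inverse>\<close>.
\<close>

definition inv_letter :: "bool \<times> 'n \<Rightarrow> bool \<times> 'n" where
  "inv_letter x = (\<not> fst x, snd x)"

definition reduced :: "(bool \<times> 'n) list \<Rightarrow> bool" where
  "reduced w \<longleftrightarrow> successively (\<lambda>x y. y \<noteq> inv_letter x) w"

fun cons_letter :: "bool \<times> 'n \<Rightarrow> (bool \<times> 'n) list \<Rightarrow> (bool \<times> 'n) list" where
  "cons_letter x [] = [x]"
| "cons_letter x (y # w) = (if y = inv_letter x then w else x # y # w)"

lemma inv_letter_inv_letter [simp]: "inv_letter (inv_letter x) = x"
  by (simp add: inv_letter_def)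

lemma inv_letter_eq_iff [simp]: "inv_letter x = inv_letter y \<longleftrightarrow> x = y"
  by (metis inv_letter_inv_letter)

lemma reduced_Nil [simp]: "reduced []"
  by (simp add: reduced_def)

lemma reduced_ConsD: "reduced (x # w) \<Longrightarrow> reduced w"
  by (auto simp: reduced_def successively_Cons)

lemma reduced_cons_letter: "reduced w \<Longrightarrow> reduced (cons_letter x w)"
  by (cases w) (auto simp: reduced_def successively_Cons)

lemma cons_letter_reduced: "reduced (x # w) \<Longrightarrow> cons_letter x w = x # w"
  by (cases w) (auto simp: reduced_def)

lemma cons_letter_inv: "reduced w \<Longrightarrow> cons_letter x (cons_letter (inv_letter x) w) = w"
  by (cases w) (auto simp: cons_letter_reduced)

lemma reduced_foldr: "reduced v \<Longrightarrow> reduced (foldr cons_letter u v)"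
  by (induction u) (auto intro: reduced_cons_letter)

lemma foldr_cons_letter_Nil: "reduced u \<Longrightarrow> foldr cons_letter u [] = u"
proof (induction u)
  case (Cons x u)
  then show ?case
    using reduced_ConsD[OF Cons.prems] by (simp add: cons_letter_reduced)
qed simp

lemma foldr_cons_letter_cons:
  assumes "reduced v"
  shows "foldr cons_letter (cons_letter x u) v = cons_letter x (foldr cons_letter u v)"
proof (cases u)
  case (Cons y us)
  show ?thesis
    using cons_letter_inv[OF reduced_foldr[OF assms, of us], of x] by (auto simp: Cons)
qed simp

lemma foldr_cons_letter_assoc:
  assumes "reduced w"
  shows "foldr cons_letter (foldr cons_letter u v) w = foldr cons_letter u (foldr cons_letter v w)"
  by (induction u) (simp_all add: foldr_cons_letter_cons[OF assms])

lemma foldr_cons_letter_inv: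
  "reduced v \<Longrightarrow> foldr cons_letter (rev (map inv_letter u)) (foldr cons_letter u v) = v"
proof (induction u arbitrary: v)
  case (Cons x u)
  have "cons_letter (inv_letter x) (cons_letter x (foldr cons_letter u v)) = foldr cons_letter u v"
    using cons_letter_inv[OF reduced_foldr[OF Cons.prems], of "inv_letter x" u] by simp
  then show ?case
    using Cons by simp
qed simp

typedef 'n free_group = "{w :: (bool \<times> 'n) list. reduced w}"
  by (rule exI[of _ "[]"]) simp

setup_lifting type_definition_free_group

instantiation free_group :: (type) "{monoid_mult, inverse}"
begin

lift_definition one_free_group :: "'n free_group" is "[]"
  by simp

text \<open>The reduction of the concatenation of two reduced words.\<close>

lift_definition times_free_group :: "'n free_group \<Rightarrow> 'n free_group \<Rightarrow> 'n free_group"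
  is "foldr cons_letter"
  by (rule reduced_foldr)

definition inverse_free_group :: "'n free_group \<Rightarrow> 'n free_group" where
  "inverse_free_group \<sigma> =
     Abs_free_group (foldr cons_letter (rev (map inv_letter (Rep_free_group \<sigma>))) [])"

definition divide_free_group :: "'n free_group \<Rightarrow> 'n free_group \<Rightarrow> 'n free_group" where
  "divide_free_group \<sigma> \<tau> = \<sigma> * inverse \<tau>"

instance
  by standard (transfer; simp add: foldr_cons_letter_assoc foldr_cons_letter_Nil)+

end

lemma free_group_left_inverse [simp]: "inverse \<sigma> * \<sigma> = (1::'n free_group)"
proof -
  have r: "reduced (Rep_free_group \<sigma>)"
    using Rep_free_group by blast
  have "Rep_free_group (inverse \<sigma> * \<sigma>) =
    foldr cons_letter (foldr cons_letter (rev (map inv_letter (Rep_free_group \<sigma>))) []) (Rep_free_group \<sigma>)"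
    by (simp add: times_free_group.rep_eq inverse_free_group_def Abs_free_group_inverse reduced_foldr)
  also have "\<dots> = foldr cons_letter (rev (map inv_letter (Rep_free_group \<sigma>)))
      (foldr cons_letter (Rep_free_group \<sigma>) [])"
    using r by (simp add: foldr_cons_letter_assoc foldr_cons_letter_Nil)
  also have "\<dots> = []"
    by (simp add: foldr_cons_letter_inv)
  finally show ?thesis
    by (metis Rep_free_group_inject one_free_group.rep_eq)
qed

lemma free_group_right_inverse [simp]: "\<sigma> * inverse \<sigma> = (1::'n free_group)"
  by (metis free_group_left_inverse mult.assoc mult_1_left mult_1_right)

lift_definition generator :: "'n \<Rightarrow> 'n free_group" is "\<lambda>i. [(True, i)]"
  by (simp add: reduced_def)

lifting_forget free_group.lifting

section \<open>The Hilbert space of square-summable functions\<close>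

typedef 'a ell2 = "{f :: 'a \<Rightarrow> complex. (\<lambda>x. (cmod (f x))\<^sup>2) summable_on UNIV}"
  by (rule exI[of _ "\<lambda>_. 0"]) simp

setup_lifting type_definition_ell2

lemma square_summable_add:
  assumes "(\<lambda>x. (cmod (f x))\<^sup>2) summable_on A" "(\<lambda>x. (cmod (g x))\<^sup>2) summable_on A"
  shows "(\<lambda>x. (cmod (f x + g x))\<^sup>2) summable_on A"
proof (rule summable_on_comparison_test)
  show "(\<lambda>x. 2 * ((cmod (f x))\<^sup>2 + (cmod (g x))\<^sup>2)) summable_on A"
    by (intro summable_on_cmult_right summable_on_add assms)
  fix x
  have "(cmod (f x + g x))\<^sup>2 \<le> (cmod (f x) + cmod (g x))\<^sup>2"
    by (intro power_mono norm_triangle_ineq) auto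
  also have "\<dots> \<le> 2 * ((cmod (f x))\<^sup>2 + (cmod (g x))\<^sup>2)"
    using sum_squares_bound[of "cmod (f x)" "cmod (g x)"] by (simp add: power2_sum)
  finally show "(cmod (f x + g x))\<^sup>2 \<le> 2 * ((cmod (f x))\<^sup>2 + (cmod (g x))\<^sup>2)" .
qed simp

lemma square_summable_scale:
  assumes "(\<lambda>x. (cmod (f x))\<^sup>2) summable_on A"
  shows "(\<lambda>x. (cmod (c * f x))\<^sup>2) summable_on A"
  using assms by (simp add: norm_mult power_mult_distrib summable_on_cmult_right)

lemma square_summable_minus:
  assumes "(\<lambda>x. (cmod (f x))\<^sup>2) summable_on A" "(\<lambda>x. (cmod (g x))\<^sup>2) summable_on A"
  shows "(\<lambda>x. (cmod (f x - g x))\<^sup>2) summable_on A"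
  using square_summable_add[OF assms(1), of "\<lambda>x. - g x"] assms(2) by simp

lemma square_summable_mult:
  assumes "(\<lambda>x. (cmod (f x))\<^sup>2) summable_on A" "(\<lambda>x. (cmod (g x))\<^sup>2) summable_on A"
  shows "(\<lambda>x. f x * cnj (g x)) summable_on A"
proof (rule Infinite_Sum.abs_summable_summable, rule Infinite_Sum.abs_summable_on_comparison_test')
  show "(\<lambda>x. (cmod (f x))\<^sup>2 + (cmod (g x))\<^sup>2) summable_on A"
    by (intro summable_on_add assms)
  fix x
  have "2 * (cmod (f x) * cmod (g x)) \<le> (cmod (f x))\<^sup>2 + (cmod (g x))\<^sup>2"
    using sum_squares_bound[of "cmod (f x)" "cmod (g x)"] by (simp add: mult.assoc)
  moreover have "0 \<le> cmod (f x) * cmod (g x)"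
    by simp
  ultimately show "norm (f x * cnj (g x)) \<le> (cmod (f x))\<^sup>2 + (cmod (g x))\<^sup>2"
    unfolding norm_mult complex_mod_cnj by linarith
qed

lemma square_summable_triangle:
  assumes f: "(\<lambda>x. (cmod (f x))\<^sup>2) summable_on UNIV" and g: "(\<lambda>x. (cmod (g x))\<^sup>2) summable_on UNIV"
  shows "sqrt (\<Sum>\<^sub>\<infinity>x. (cmod (f x + g x))\<^sup>2) \<le> sqrt (\<Sum>\<^sub>\<infinity>x. (cmod (f x))\<^sup>2) + sqrt (\<Sum>\<^sub>\<infinity>x. (cmod (g x))\<^sup>2)"
    (is "_ \<le> ?a + ?b")
proof -
  have nn: "0 \<le> ?a + ?b"
    by (intro add_nonneg_nonneg real_sqrt_ge_zero infsum_nonneg) auto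
  have "(\<Sum>\<^sub>\<infinity>x. (cmod (f x + g x))\<^sup>2) \<le> (?a + ?b)\<^sup>2"
  proof (rule infsum_le_finite_sums[OF square_summable_add[OF f g]])
    fix F :: "'a set" assume F: "finite F"
    have le: "sqrt (\<Sum>x\<in>F. (cmod (h x))\<^sup>2) \<le> sqrt (\<Sum>\<^sub>\<infinity>x. (cmod (h x))\<^sup>2)"
      if "(\<lambda>x. (cmod (h x))\<^sup>2) summable_on UNIV" for h :: "'a \<Rightarrow> complex"
      by (intro real_sqrt_le_mono finite_sum_le_infsum that F) auto
    have "L2_set (\<lambda>x. cmod (f x + g x)) F \<le> L2_set (\<lambda>x. cmod (f x) + cmod (g x)) F"
      by (intro L2_set_mono norm_triangle_ineq) auto
    also have "\<dots> \<le> L2_set (\<lambda>x. cmod (f x)) F + L2_set (\<lambda>x. cmod (g x)) F"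
      by (rule L2_set_triangle_ineq)
    also have "\<dots> \<le> ?a + ?b"
      unfolding L2_set_def by (intro add_mono le f g)
    finally show "(\<Sum>x\<in>F. (cmod (f x + g x))\<^sup>2) \<le> (?a + ?b)\<^sup>2"
      by (simp add: L2_set_def sqrt_le_D)
  qed
  then show ?thesis
    using nn by (simp add: real_le_lsqrt infsum_nonneg)
qed

instantiation ell2 :: (type) complex_inner
begin

lift_definition zero_ell2 :: "'a ell2" is "\<lambda>_. 0" by simp
lift_definition plus_ell2 :: "'a ell2 \<Rightarrow> 'a ell2 \<Rightarrow> 'a ell2" is "\<lambda>f g x. f x + g x"
  by (rule square_summable_add)
lift_definition minus_ell2 :: "'a ell2 \<Rightarrow> 'a ell2 \<Rightarrow> 'a ell2" is "\<lambda>f g x. f x - g x"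
  by (rule square_summable_minus)
lift_definition uminus_ell2 :: "'a ell2 \<Rightarrow> 'a ell2" is "\<lambda>f x. - f x" by simp
lift_definition scaleC_ell2 :: "complex \<Rightarrow> 'a ell2 \<Rightarrow> 'a ell2" is "\<lambda>c f x. c * f x"
  by (rule square_summable_scale)
lift_definition scaleR_ell2 :: "real \<Rightarrow> 'a ell2 \<Rightarrow> 'a ell2" is "\<lambda>r f x. complex_of_real r * f x"
  by (rule square_summable_scale)
lift_definition cinner_ell2 :: "'a ell2 \<Rightarrow> 'a ell2 \<Rightarrow> complex" is "\<lambda>f g. \<Sum>\<^sub>\<infinity>x. f x * cnj (g x)" .
lift_definition norm_ell2 :: "'a ell2 \<Rightarrow> real" is "\<lambda>f. sqrt (\<Sum>\<^sub>\<infinity>x. (cmod (f x))\<^sup>2)" .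

definition sgn_ell2 :: "'a ell2 \<Rightarrow> 'a ell2" where "sgn_ell2 f = scaleR (inverse (norm f)) f"
definition dist_ell2 :: "'a ell2 \<Rightarrow> 'a ell2 \<Rightarrow> real" where "dist_ell2 f g = norm (f - g)"
definition uniformity_ell2 :: "('a ell2 \<times> 'a ell2) filter" where
  "uniformity_ell2 = (INF e\<in>{0 <..}. principal {(f, g). dist f g < e})"
definition open_ell2 :: "'a ell2 set \<Rightarrow> bool" where
  "open_ell2 S = (\<forall>f\<in>S. \<forall>\<^sub>F (f', g) in uniformity. f' = f \<longrightarrow> g \<in> S)"

instance
proof
  fix x y z :: "'a ell2" and r s :: real and c d :: complex and S :: "'a ell2 set"
  show "x + y + z = x + (y + z)" "x + y = y + x" "0 + x = x" "- x + x = 0" "x - y = x + - y"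
    by (transfer; simp add: algebra_simps)+
  show "r *\<^sub>R (x + y) = r *\<^sub>R x + r *\<^sub>R y" "(r + s) *\<^sub>R x = r *\<^sub>R x + s *\<^sub>R x"
    "r *\<^sub>R s *\<^sub>R x = (r * s) *\<^sub>R x" "1 *\<^sub>R x = x"
    by (transfer; simp add: algebra_simps)+
  show "c *\<^sub>C (x + y) = c *\<^sub>C x + c *\<^sub>C y" "(c + d) *\<^sub>C x = c *\<^sub>C x + d *\<^sub>C x"
    "c *\<^sub>C d *\<^sub>C x = (c * d) *\<^sub>C x" "complex_of_real r *\<^sub>C x = r *\<^sub>R x"
    by (transfer; simp add: algebra_simps)+
  show "sgn x = scaleR (inverse (norm x)) x" "dist x y = norm (x - y)"
    "uniformity = (INF e\<in>{0 <..}. principal {(x, y :: 'a ell2). dist x y < e})"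
    "open S = (\<forall>x\<in>S. \<forall>\<^sub>F (x', y) in uniformity. x' = x \<longrightarrow> y \<in> S)"
    by (rule sgn_ell2_def dist_ell2_def uniformity_ell2_def open_ell2_def)+
  show "norm x = 0 \<longleftrightarrow> x = 0"
  proof transfer
    fix f :: "'a \<Rightarrow> complex" assume f: "(\<lambda>x. (cmod (f x))\<^sup>2) summable_on UNIV"
    show "sqrt (\<Sum>\<^sub>\<infinity>x. (cmod (f x))\<^sup>2) = 0 \<longleftrightarrow> f = (\<lambda>_. 0)"
    proof
      assume "sqrt (\<Sum>\<^sub>\<infinity>x. (cmod (f x))\<^sup>2) = 0"
      then have "(\<Sum>\<^sub>\<infinity>x. (cmod (f x))\<^sup>2) \<le> 0" by simp
      from nonneg_infsum_le_0D[OF this f] have "(cmod (f x))\<^sup>2 = 0" for x by simp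
      then show "f = (\<lambda>_. 0)" by auto
    qed simp
  qed
  show "norm (x + y) \<le> norm x + norm y"
    by transfer (rule square_summable_triangle)
  show "norm (r *\<^sub>R x) = \<bar>r\<bar> * norm x"
    by transfer (simp add: norm_mult power_mult_distrib infsum_cmult_right' real_sqrt_mult)
  show "cinner x y = cnj (cinner y x)"
    by transfer (simp add: mult.commute flip: infsum_cnj)
  show "cinner (x + y) z = cinner x z + cinner y z"
    by transfer (simp add: distrib_right infsum_add square_summable_mult)
  show "cinner (c *\<^sub>C x) y = c * cinner x y"
    by transfer (simp add: mult.assoc infsum_cmult_right')
  show "cinner x x = complex_of_real ((norm x)\<^sup>2)"
  proof transfer
    fix f :: "'a \<Rightarrow> complex"
    have "(\<Sum>\<^sub>\<infinity>x. f x * cnj (f x)) = (\<Sum>\<^sub>\<infinity>x. complex_of_real ((cmod (f x))\<^sup>2))"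
      by (simp only: complex_norm_square)
    also assume f: "(\<lambda>x. (cmod (f x))\<^sup>2) summable_on UNIV"
    then have "(\<Sum>\<^sub>\<infinity>x. complex_of_real ((cmod (f x))\<^sup>2)) = complex_of_real (\<Sum>\<^sub>\<infinity>x. (cmod (f x))\<^sup>2)"
      by (metis has_sum_of_real has_sum_infsum infsumI)
    finally show "(\<Sum>\<^sub>\<infinity>x. f x * cnj (f x)) = complex_of_real ((sqrt (\<Sum>\<^sub>\<infinity>x. (cmod (f x))\<^sup>2))\<^sup>2)"
      by (simp add: infsum_nonneg)
  qed
qed

end

instance ell2 :: (type) chilbert_space
proof
  fix X :: "nat \<Rightarrow> 'a ell2" assume X: "Cauchy X"
  have fin: "(\<Sum>x\<in>F. (cmod (Rep_ell2 f x))\<^sup>2) \<le> (norm f)\<^sup>2" if "finite F" for F and f :: "'a ell2"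
    using that
  proof transfer
    fix F :: "'a set" and f :: "'a \<Rightarrow> complex"
    assume "finite F" "(\<lambda>x. (cmod (f x))\<^sup>2) summable_on UNIV"
    then have "(\<Sum>x\<in>F. (cmod (f x))\<^sup>2) \<le> (\<Sum>\<^sub>\<infinity>x. (cmod (f x))\<^sup>2)"
      by (intro finite_sum_le_infsum) auto
    then show "(\<Sum>x\<in>F. (cmod (f x))\<^sup>2) \<le> (sqrt (\<Sum>\<^sub>\<infinity>x. (cmod (f x))\<^sup>2))\<^sup>2"
      by (simp add: infsum_nonneg)
  qed
  have "Cauchy (\<lambda>k. Rep_ell2 (X k) x)" for x
  proof (rule metric_CauchyI)
    fix e :: real assume "0 < e"
    then obtain M where M: "\<forall>m\<ge>M. \<forall>n\<ge>M. dist (X m) (X n) < e"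
      using metric_CauchyD[OF X] by blast
    have "cmod (Rep_ell2 (X m) x - Rep_ell2 (X n) x) \<le> dist (X m) (X n)" for m n
      using fin[of "{x}" "X m - X n"] by (simp add: minus_ell2.rep_eq dist_norm power2_le_iff_abs_le)
    then show "\<exists>M. \<forall>m\<ge>M. \<forall>n\<ge>M. dist (Rep_ell2 (X m) x) (Rep_ell2 (X n) x) < e"
      using M by (metis dist_norm order.strict_trans1)
  qed
  then have "\<exists>l. (\<lambda>k. Rep_ell2 (X k) x) \<longlonglongrightarrow> l" for x
    using Cauchy_convergent_iff convergent_def by blast
  then obtain L where L: "(\<lambda>k. Rep_ell2 (X k) x) \<longlonglongrightarrow> L x" for x
    by metis
  have tail: "(\<Sum>x\<in>F. (cmod (Rep_ell2 (X m) x - L x))\<^sup>2) \<le> e\<^sup>2"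
    if M: "\<forall>m\<ge>M. \<forall>n\<ge>M. dist (X m) (X n) < e" and "m \<ge> M" and F: "finite F" for e M m F
  proof (rule LIMSEQ_le_const2)
    show "(\<lambda>k. \<Sum>x\<in>F. (cmod (Rep_ell2 (X m) x - Rep_ell2 (X k) x))\<^sup>2)
        \<longlonglongrightarrow> (\<Sum>x\<in>F. (cmod (Rep_ell2 (X m) x - L x))\<^sup>2)"
      by (intro tendsto_intros L)
    have "(\<Sum>x\<in>F. (cmod (Rep_ell2 (X m) x - Rep_ell2 (X k) x))\<^sup>2) \<le> e\<^sup>2" if "k \<ge> M" for k
    proof -
      have "(\<Sum>x\<in>F. (cmod (Rep_ell2 (X m) x - Rep_ell2 (X k) x))\<^sup>2) \<le> (norm (X m - X k))\<^sup>2"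
        using fin[OF F, of "X m - X k"] by (simp add: minus_ell2.rep_eq)
      also have "\<dots> \<le> e\<^sup>2"
        using M \<open>m \<ge> M\<close> that by (intro power_mono) (auto simp: dist_norm less_imp_le)
      finally show ?thesis .
    qed
    then show "\<exists>N. \<forall>k\<ge>N. (\<Sum>x\<in>F. (cmod (Rep_ell2 (X m) x - Rep_ell2 (X k) x))\<^sup>2) \<le> e\<^sup>2"
      by blast
  qed
  have diff: "(\<lambda>x. (cmod (Rep_ell2 (X m) x - L x))\<^sup>2) summable_on UNIV"
    if "\<forall>m\<ge>M. \<forall>n\<ge>M. dist (X m) (X n) < e" and "m \<ge> M" for e M m
    using tail[OF that] by (intro nonneg_bdd_above_summable_on bdd_aboveI2[where M = "e\<^sup>2"]) auto
  obtain M where M: "\<forall>m\<ge>M. \<forall>n\<ge>M. dist (X m) (X n) < 1"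
    using metric_CauchyD[OF X, of 1] by auto
  have "(\<lambda>x. (cmod (Rep_ell2 (X M) x - (Rep_ell2 (X M) x - L x)))\<^sup>2) summable_on UNIV"
    using Rep_ell2[of "X M"] by (intro square_summable_minus diff[OF M]) auto
  then have L_mem: "Rep_ell2 (Abs_ell2 L) = L"
    by (intro Abs_ell2_inverse) simp
  have "X \<longlonglongrightarrow> Abs_ell2 L"
  proof (rule metric_LIMSEQ_I)
    fix e :: real assume e: "0 < e"
    then obtain M where M: "\<forall>m\<ge>M. \<forall>n\<ge>M. dist (X m) (X n) < e / 2"
      using metric_CauchyD[OF X, of "e / 2"] by auto
    have "dist (X m) (Abs_ell2 L) < e" if "m \<ge> M" for m
    proof -
      have "(\<Sum>\<^sub>\<infinity>x. (cmod (Rep_ell2 (X m) x - L x))\<^sup>2) \<le> (e / 2)\<^sup>2"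
        by (intro infsum_le_finite_sums diff[OF M that] tail[OF M that])
      then have "norm (X m - Abs_ell2 L) \<le> e / 2"
        unfolding norm_ell2.rep_eq minus_ell2.rep_eq L_mem
        using e by (intro real_le_lsqrt) auto
      then show ?thesis
        using e by (simp add: dist_norm)
    qed
    then show "\<exists>M. \<forall>m\<ge>M. dist (X m) (Abs_ell2 L) < e"
      by blast
  qed
  then show "convergent X"
    by (rule convergentI)
qed

lift_definition ket :: "'a \<Rightarrow> 'a ell2" is "\<lambda>\<sigma> \<tau>. if \<tau> = \<sigma> then 1 else 0"
proof -
  fix \<sigma> :: 'a
  have "(\<lambda>\<tau>. (cmod (if \<tau> = \<sigma> then 1 else 0))\<^sup>2) summable_on UNIV \<longleftrightarrow>
      (\<lambda>\<tau>. (cmod (if \<tau> = \<sigma> then 1 else 0))\<^sup>2) summable_on {\<sigma>}"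
    by (rule summable_on_cong_neutral) auto
  then show "(\<lambda>\<tau>. (cmod (if \<tau> = \<sigma> then 1 else 0))\<^sup>2) summable_on UNIV"
    by simp
qed

section \<open>The reduced group algebra of the free group\<close>

lemma bij_free_group_mult: "bij (\<lambda>\<tau>. \<sigma> * \<tau> :: 'n free_group)"
  by (rule bij_betw_byWitness[where f' = "\<lambda>\<tau>. inverse \<sigma> * \<tau>"]) (auto simp flip: mult.assoc)

lift_definition left_translation :: "'n free_group \<Rightarrow> 'n free_group ell2 \<Rightarrow> 'n free_group ell2"
  is "\<lambda>\<sigma> f \<tau>. f (inverse \<sigma> * \<tau>)"
proof -
  fix \<sigma> :: "'n free_group" and f :: "'n free_group \<Rightarrow> complex"
  assume "(\<lambda>\<tau>. (cmod (f \<tau>))\<^sup>2) summable_on UNIV"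
  then show "(\<lambda>\<tau>. (cmod (f (inverse \<sigma> * \<tau>)))\<^sup>2) summable_on UNIV"
    using summable_on_reindex_bij_betw[OF bij_free_group_mult, where f = "\<lambda>\<tau>. (cmod (f \<tau>))\<^sup>2"] by blast
qed

text \<open>The unitaries \<open>U\<^sub>i\<close>; the defining property \<open>U\<^sub>i \<xi>\<^sub>\<sigma> = \<xi>\<^bsub>g\<^sub>i\<sigma>\<^esub>\<close> is lemma \<open>unitary_ket\<close>.\<close>

definition unitary :: "'n \<Rightarrow> 'n free_group ell2 \<Rightarrow> 'n free_group ell2" where
  "unitary i = left_translation (generator i)"

lemma unitary_ket: "unitary i (ket \<sigma>) = ket (generator i * \<sigma>)"
  unfolding unitary_def
proof (rule Rep_ell2_inject[THEN iffD1], rule ext)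
  fix \<tau>
  have "inverse (generator i) * \<tau> = \<sigma> \<longleftrightarrow> \<tau> = generator i * \<sigma>"
    by (metis free_group_left_inverse free_group_right_inverse mult.assoc mult_1_left)
  then show "Rep_ell2 (left_translation (generator i) (ket \<sigma>)) \<tau> = Rep_ell2 (ket (generator i * \<sigma>)) \<tau>"
    by (simp add: left_translation.rep_eq ket.rep_eq)
qed

lemma norm_unitary: "norm (unitary i f) = norm f"
  unfolding unitary_def
  by transfer (simp add: infsum_reindex_bij_betw[OF bij_free_group_mult, of "\<lambda>\<tau>. (cmod (_ \<tau>))\<^sup>2"])

lemma unitary_bounded: "unitary i \<in> bounded_operators"
proof -
  have "bounded_linear (unitary i)"
  proof (rule bounded_linear_intro[where K = 1])
    show "unitary i (f + g) = unitary i f + unitary i g" for f g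
      unfolding unitary_def by transfer simp
    show "unitary i (r *\<^sub>R f) = r *\<^sub>R unitary i f" for r f
      unfolding unitary_def by transfer simp
  qed (simp add: norm_unitary)
  moreover have "unitary i (c *\<^sub>C f) = c *\<^sub>C unitary i f" for c f
    unfolding unitary_def by transfer simp
  ultimately show ?thesis
    by (simp add: bounded_operators_def)
qed

lemma cadjoint_unitary:
  fixes i :: 'n
  shows "cadjoint (unitary i) = left_translation (inverse (generator i))"
proof (rule cadjoint_eqI)
  fix f g :: "'n free_group ell2"
  have inv: "inverse (inverse \<sigma>) = \<sigma>" for \<sigma> :: "'n free_group"
    by (metis free_group_left_inverse free_group_right_inverse mult.assoc mult_1_left mult_1_right)
  show "cinner (unitary i f) g = cinner f (left_translation (inverse (generator i)) g)"
    unfolding unitary_def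
  proof transfer
    fix i :: 'n and f g :: "'n free_group \<Rightarrow> complex"
    show "(\<Sum>\<^sub>\<infinity>\<tau>. f (inverse (generator i) * \<tau>) * cnj (g \<tau>)) =
        (\<Sum>\<^sub>\<infinity>\<tau>. f \<tau> * cnj (g (inverse (inverse (generator i)) * \<tau>)))"
      using infsum_reindex_bij_betw[OF bij_free_group_mult[of "generator i"],
          of "\<lambda>\<tau>. f (inverse (generator i) * \<tau>) * cnj (g \<tau>)"]
      by (simp add: inv flip: mult.assoc)
  qed
qed

lemma unitary_cadjoint: "unitary i \<circ> cadjoint (unitary i) = id" "cadjoint (unitary i) \<circ> unitary i = id"
proof -
  have inv: "inverse (inverse \<sigma>) = \<sigma>" for \<sigma> :: "'n free_group"
    by (metis free_group_left_inverse free_group_right_inverse mult.assoc mult_1_left mult_1_right)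
  show "unitary i \<circ> cadjoint (unitary i) = id" "cadjoint (unitary i) \<circ> unitary i = id"
    unfolding cadjoint_unitary
    by (auto simp: unitary_def fun_eq_iff left_translation.rep_eq inv
        simp flip: Rep_ell2_inject mult.assoc)
qed

definition Cstar_red :: "('n free_group ell2 \<Rightarrow> 'n free_group ell2) set" where
  "Cstar_red = cstar_generated (range unitary)"

definition Hpoly :: "nat \<Rightarrow> ('n::finite list \<Rightarrow> complex) \<Rightarrow> 'n free_group ell2 \<Rightarrow> 'n free_group ell2" where
  "Hpoly m a = (\<lambda>x.
     (\<Sum>k=1..m-1. homogeneous_sum k (\<lambda>\<alpha>. cnj (a \<alpha>)) (\<lambda>\<alpha>. cadjoint (op_word unitary \<alpha>)) x)
     + a [] *\<^sub>C x
     + (\<Sum>k=1..m-1. homogeneous_sum k a (op_word unitary) x))"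

text \<open>Membership in the reduced \<open>C\<^sup>*\<close>-algebra is automatic for \<open>Hpoly\<close>.\<close>

lemma Cstar_red_sum:
  assumes "finite A" "\<And>k. k \<in> A \<Longrightarrow> f k \<in> (Cstar_red :: ('n::finite free_group ell2 \<Rightarrow> _) set)"
  shows "(\<lambda>x. \<Sum>k\<in>A. f k x) \<in> Cstar_red"
  using assms
proof (induction rule: finite_induct)
  case empty
  have "(\<lambda>x::'n free_group ell2. 0 *\<^sub>C unitary undefined x) \<in> Cstar_red"
    unfolding Cstar_red_def by (intro cstar_generated.scale cstar_generated.gen) simp
  moreover have "0 *\<^sub>C x = 0" for x :: "'n free_group ell2"
    using scaleC_of_real[of 0 x] by simp
  ultimately show ?case by simp
next
  case (insert k A)
  then show ?case
    unfolding Cstar_red_def by (simp add: cstar_generated.add)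
qed

lemma op_word_unitary_Cstar_red: "op_word unitary \<alpha> \<in> Cstar_red"
  unfolding Cstar_red_def
proof (induction \<alpha>)
  case Nil
  have "unitary undefined \<circ> cadjoint (unitary undefined) \<in> cstar_generated (range (unitary :: 'a \<Rightarrow> _))"
    by (intro cstar_generated.comp cstar_generated.adj cstar_generated.gen) auto
  then show ?case by (simp only: unitary_cadjoint op_word.simps)
next
  case (Cons i \<alpha>)
  show ?case
    unfolding op_word.simps by (rule cstar_generated.comp[OF cstar_generated.gen Cons]) simp
qed

lemma homogeneous_sum_Cstar_red:
  fixes V :: "'n::finite list \<Rightarrow> 'n free_group ell2 \<Rightarrow> 'n free_group ell2"
  assumes "\<And>\<alpha>. V \<alpha> \<in> Cstar_red"
  shows "homogeneous_sum k c V \<in> Cstar_red"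
  unfolding homogeneous_sum_def
proof (rule Cstar_red_sum)
  show "finite {\<alpha> :: 'n list. length \<alpha> = k}"
    using finite_lists_length_eq[of "UNIV :: 'n set" k] by simp
  show "(\<lambda>x. c \<alpha> *\<^sub>C V \<alpha> x) \<in> Cstar_red" for \<alpha>
    using assms[of \<alpha>] unfolding Cstar_red_def by (rule cstar_generated.scale)
qed

lemma Hpoly_Cstar_red:
  fixes a :: "'n::finite list \<Rightarrow> complex"
  shows "Hpoly m a \<in> Cstar_red"
proof -
  note add = cstar_generated.add[of _ "range unitary", folded Cstar_red_def]
  have 1: "(\<lambda>x :: 'n free_group ell2. a [] *\<^sub>C x) \<in> Cstar_red"
    using op_word_unitary_Cstar_red[of "[]"] cstar_generated.scale[of id _ "a []"]
    by (simp add: Cstar_red_def)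
  have 2: "cadjoint (op_word unitary \<alpha>) \<in> Cstar_red" for \<alpha> :: "'n list"
    using op_word_unitary_Cstar_red[of \<alpha>] unfolding Cstar_red_def by (rule cstar_generated.adj)
  show ?thesis
    unfolding Hpoly_def
    by (intro add Cstar_red_sum homogeneous_sum_Cstar_red 1 2 op_word_unitary_Cstar_red finite_atLeastAtMost)
qed

section \<open>The constants\<close>

definition cos_poly :: "nat \<Rightarrow> real \<Rightarrow> real" where
  "cos_poly m t = (\<Sum>k=1..m-1. t ^ k * cos (pi / (real ((m - 1) div k) + 2)))"

text \<open>
  For \<open>m = 2\<close> the equation \<open>cos_poly m t = 1\<close> reads \<open>t / 2 = 1\<close>, and its only solution is \<open>2\<close>;
  for \<open>m \<ge> 3\<close> its positive solution lies in \<open>(0, 1]\<close>. So \<open>gamma_const\<close> is the positive solution.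
\<close>

definition gamma_const :: "nat \<Rightarrow> real" where
  "gamma_const m = (THE t. 0 < t \<and> cos_poly m t = 1)"

definition t_const :: "nat \<Rightarrow> real" where
  "t_const m = (THE t. 0 < t \<and> t \<le> 1 \<and> cos_poly m t = 1/2)"

end

theory Submission
  imports Defs
begin

text \<open>
  The bound on the coefficients of length \<open>k\<close> is Fejer's inequality for a scalar trigonometric polynomial.
  Let \<open>u\<close> be the unit vector proportional to \<open>(a\<^sub>\<alpha>)\<close>, \<open>|\<alpha>| = k\<close>, and let \<open>v\<^sub>j\<close> be the
  superposition of the positive words made of \<open>j\<close> blocks of length \<open>k\<close>, weighted by the product of
  the \<open>u\<close>-weights of the blocks. The \<open>v\<^sub>j\<close> are orthonormal, and \<open>U\<^sub>\<alpha>\<close> has no matrix entry between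
  them unless \<open>k\<close> divides \<open>|\<alpha>|\<close>. Testing \<open>H\<close> on \<open>\<Sum>j<L. cnj z ^ j v\<^sub>j\<close> with \<open>|z| = 1\<close>, dividing by \<open>L\<close> and
  letting \<open>L\<close> grow gives \<open>|a\<^sub>0 + 2 Re (\<Sum>l=1..d. B\<^sub>l z ^ l)| \<le> 1\<close> with \<open>d = [(m - 1) / k]\<close>, where \<open>B\<^sub>1\<close> is the
  Euclidean norm of \<open>(a\<^sub>\<alpha>)\<close>, \<open>|\<alpha>| = k\<close>.

  The operator inequalities follow because the row of all \<open>T\<^sub>\<alpha>\<close>, \<open>|\<alpha>| = k\<close>, has norm at most \<open>r\<^sup>k\<close>
  for \<open>T\<close> in the ball of radius \<open>r\<close>.
\<close>

section \<open>Adjoints of bounded operators\<close>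

lemma cinner_scaleC_right: "cinner x (c *\<^sub>C y) = cnj c * cinner (x::'a::complex_inner) y"
  by (metis cinner_commute cinner_scaleC_left complex_cnj_mult)

lemma cinner_scaleR_left: "cinner (r *\<^sub>R x) y = complex_of_real r * cinner (x::'a::complex_inner) y"
  by (metis cinner_scaleC_left scaleC_of_real)

lemma cinner_zero_left [simp]: "cinner 0 (y::'a::complex_inner) = 0"
  using cinner_add_left[of 0 0 y] by simp

lemma cinner_zero_right [simp]: "cinner (x::'a::complex_inner) 0 = 0"
  using cinner_add_right[of x 0 0] by simp

lemma cinner_sum_left: "cinner (\<Sum>i\<in>A. f i) (y::'a::complex_inner) = (\<Sum>i\<in>A. cinner (f i) y)"
  by (induction A rule: infinite_finite_induct) (simp_all add: cinner_add_left)

lemma cinner_sum_right: "cinner (x::'a::complex_inner) (\<Sum>i\<in>A. f i) = (\<Sum>i\<in>A. cinner x (f i))"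
  by (induction A rule: infinite_finite_induct) (simp_all add: cinner_add_right)

lemma scaleC_zero_left [simp]: "0 *\<^sub>C (x::'a::complex_inner) = 0"
  using scaleC_of_real[of 0 x] by simp

lemma scaleC_zero_right [simp]: "c *\<^sub>C (0::'a::complex_inner) = 0"
  using scaleC_add_right[of c 0 "0::'a"] by simp

lemma scaleC_sum_right: "c *\<^sub>C (\<Sum>i\<in>A. f i) = (\<Sum>i\<in>A. c *\<^sub>C (f i :: 'a::complex_inner))"
  by (induction A rule: infinite_finite_induct) (simp_all add: scaleC_add_right)

lemma scaleC_scaleR: "c *\<^sub>C r *\<^sub>R x = r *\<^sub>R c *\<^sub>C (x::'a::complex_inner)"
  by (metis mult.commute scaleC_of_real scaleC_scaleC)

lemma norm_scaleC: "norm (c *\<^sub>C x) = cmod c * norm (x::'a::complex_inner)"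
proof -
  have "complex_of_real ((norm (c *\<^sub>C x))\<^sup>2) = c * cnj c * complex_of_real ((norm x)\<^sup>2)"
    by (simp only: cinner_self[symmetric] cinner_scaleC_left cinner_scaleC_right mult_ac)
  also have "\<dots> = complex_of_real ((cmod c * norm x)\<^sup>2)"
    by (simp add: power_mult_distrib complex_norm_square[symmetric])
  finally have "(norm (c *\<^sub>C x))\<^sup>2 = (cmod c * norm x)\<^sup>2"
    by (simp only: of_real_eq_iff)
  then show ?thesis by simp
qed

lemma Re_cinner_self: "Re (cinner x x) = (norm (x::'a::complex_inner))\<^sup>2"
  by (simp add: cinner_self)

lemma Re_cinner_commute: "Re (cinner x y) = Re (cinner y (x::'a::complex_inner))"
  by (subst cinner_commute) simp

lemma norm_add_squared:
  "(norm (x + y :: 'a::complex_inner))\<^sup>2 = (norm x)\<^sup>2 + (norm y)\<^sup>2 + 2 * Re (cinner x y)"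
  using Re_cinner_commute[of x y]
  by (simp add: Re_cinner_self[symmetric] cinner_add_left cinner_add_right)

text \<open>Squaring the triangle inequality, which the norm has by its class, leaves only the mixed
  term.\<close>

lemma Re_cinner_le: "Re (cinner x y) \<le> norm x * norm (y::'a::complex_inner)"
proof -
  have "(norm (x + y))\<^sup>2 \<le> (norm x + norm y)\<^sup>2"
    by (intro power_mono norm_triangle_ineq) auto
  then show ?thesis
    by (simp add: norm_add_squared power2_sum)
qed

lemma cmod_cinner_le: "cmod (cinner x y) \<le> norm x * norm (y::'a::complex_inner)"
proof (cases "cinner x y = 0")
  case False
  \<comment> \<open>A phase that rotates the inner product onto the nonnegative real axis reduces
    the claim to real parts.\<close>
  define c where "c = cnj (sgn (cinner x y))"
  have "c * cinner x y = complex_of_real (cmod (cinner x y))"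
    using False complex_norm_square[of "cinner x y"]
    by (simp add: c_def sgn_eq power2_eq_square field_simps)
  then have "cmod (cinner x y) = Re (cinner (c *\<^sub>C x) y)"
    by (simp add: cinner_scaleC_left)
  also have "\<dots> \<le> norm (c *\<^sub>C x) * norm y"
    by (rule Re_cinner_le)
  also have "norm (c *\<^sub>C x) = norm x"
    using False by (simp add: norm_scaleC c_def norm_sgn)
  finally show ?thesis .
qed simp

section \<open>The Riesz representation theorem\<close>

lemma linear_coefficient_zero:
  fixes a b :: real
  assumes "\<And>t. 0 \<le> a * t\<^sup>2 + b * t"
  shows "b = 0"
proof (rule ccontr)
  assume b: "b \<noteq> 0"
  show False
  proof (cases "a \<le> 0")
    case True
    then have "a * (- b)\<^sup>2 + b * (- b) < 0"
      using b by (smt (verit) mult_nonneg_nonneg mult_nonpos_nonneg not_real_square_gt_zero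
          power2_eq_square mult_minus_right zero_le_power2)
    then show False using assms[of "- b"] by simp
  next
    case False
    \<comment> \<open>The vertex of the parabola, where the value is negative.\<close>
    have "a * (- b / (2 * a))\<^sup>2 + b * (- b / (2 * a)) = - (b\<^sup>2 / (4 * a))"
      using False by (simp add: field_simps power2_eq_square)
    moreover have "b\<^sup>2 / (4 * a) > 0"
      using b False by simp
    ultimately show False using assms[of "- b / (2 * a)"] by linarith
  qed
qed

lemma parallelogram:
  "(norm (x - y :: 'a::complex_inner))\<^sup>2 = 2 * (norm x)\<^sup>2 + 2 * (norm y)\<^sup>2 - (norm (x + y))\<^sup>2"
proof -
  have "(norm (x - y))\<^sup>2 = (norm x)\<^sup>2 + (norm y)\<^sup>2 - 2 * Re (cinner x y)"
    using norm_add_squared[of x "(-1) *\<^sub>C y"] scaleC_of_real[of "-1" y]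
    by (simp add: cinner_scaleC_right)
  then show ?thesis
    by (simp add: norm_add_squared)
qed

text \<open>The representing vector minimises \<open>\<parallel>x\<parallel>\<^sup>2 - 2 Re (\<phi> x)\<close>.\<close>

theorem riesz_representation:
  fixes \<phi> :: "'a::chilbert_space \<Rightarrow> complex"
  assumes \<phi>: "bounded_linear \<phi>" and homogeneous: "\<And>c x. \<phi> (c *\<^sub>C x) = c * \<phi> x"
  shows "\<exists>z. \<forall>x. \<phi> x = cinner x z"
proof -
  interpret bounded_linear \<phi> by fact
  define J where "J x = (norm x)\<^sup>2 - 2 * Re (\<phi> x)" for x
  obtain K where K: "cmod (\<phi> x) \<le> norm x * K" for x
    using bounded by blast
  \<comment> \<open>Completing the square with the bound \<open>K\<close> shows that
    \<open>J\<close> is bounded below.\<close>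
  have "J x \<ge> - K\<^sup>2" for x
  proof -
    have "Re (\<phi> x) \<le> norm x * K"
      using K[of x] complex_Re_le_cmod order_trans by blast
    moreover have "0 \<le> (norm x - K)\<^sup>2" by simp
    ultimately show ?thesis
      by (simp add: J_def power2_diff)
  qed
  then have bdd: "bdd_below (range J)"
    by (intro bdd_belowI2)
  define m where "m = Inf (range J)"
  have m_le: "m \<le> J x" for x
    unfolding m_def by (intro cInf_lower bdd) simp
  have "\<exists>x. J x < m + 1 / real (Suc n)" for n
    using cInf_lessD[of "range J" "m + 1 / real (Suc n)"] by (auto simp: m_def)
  then obtain X where X: "J (X n) < m + 1 / real (Suc n)" for n
    by metis
  \<comment> \<open>The parallelogram law, with \<open>m\<close> as a lower bound of
    \<open>J\<close> at the midpoint, keeps near-minimisers close together; hence a minimising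
    sequence is Cauchy.\<close>
  have dist2: "(norm (x - y))\<^sup>2 \<le> 2 * (J x - m) + 2 * (J y - m)" for x y
  proof -
    have "4 * J ((1/2) *\<^sub>R (x + y)) = (norm (x + y))\<^sup>2 - 4 * Re (\<phi> x) - 4 * Re (\<phi> y)"
      unfolding J_def norm_scaleR scaleR add by (simp add: power_mult_distrib power_divide field_simps)
    then have "(norm (x - y))\<^sup>2 = 2 * J x + 2 * J y - 4 * J ((1/2) *\<^sub>R (x + y))"
      by (simp add: parallelogram J_def)
    with m_le[of "(1/2) *\<^sub>R (x + y)"] show ?thesis by simp
  qed
  have "Cauchy X"
  proof (rule metric_CauchyI)
    fix e :: real assume e: "0 < e"
    obtain N where N: "inverse (real (Suc N)) < e\<^sup>2 / 4"
      using reals_Archimedean[of "e\<^sup>2 / 4"] e by auto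
    have "dist (X i) (X j) < e" if "i \<ge> N" "j \<ge> N" for i j
    proof -
      have "J (X i) - m < e\<^sup>2 / 4" if "i \<ge> N" for i
      proof -
        have "1 / real (Suc i) \<le> inverse (real (Suc N))"
          using that by (simp add: field_simps)
        with X[of i] N show ?thesis by linarith
      qed
      from this[OF that(1)] this[OF that(2)] have "(norm (X i - X j))\<^sup>2 < e\<^sup>2"
        using dist2[of "X i" "X j"] by argo
      then show ?thesis
        using e by (simp add: dist_norm power2_less_imp_less)
    qed
    then show "\<exists>N. \<forall>i\<ge>N. \<forall>j\<ge>N. dist (X i) (X j) < e" by blast
  qed
  then obtain z where z: "X \<longlonglongrightarrow> z"
    using Cauchy_convergent_iff convergent_def by blast
  have "(\<lambda>n. J (X n)) \<longlonglongrightarrow> J z"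
    unfolding J_def by (intro tendsto_intros z tendsto)
  moreover have "(\<lambda>n. m + 1 / real (Suc n)) \<longlonglongrightarrow> m + 0"
    by (intro tendsto_intros LIMSEQ_Suc[OF lim_1_over_n])
  ultimately have "J z \<le> m"
    using X by (intro tendsto_le[OF sequentially_bot]) (auto intro!: always_eventually less_imp_le)
  then have min: "J z \<le> J x" for x
    using m_le order_trans by blast
  \<comment> \<open>First variation: the quadratic below is
    \<open>J (z + t *\<^sub>R x) - J z\<close>, so its linear coefficient vanishes.\<close>
  have Re_eq: "Re (\<phi> x) = Re (cinner x z)" for x
  proof -
    have "0 \<le> (norm x)\<^sup>2 * t\<^sup>2 + (2 * (Re (cinner x z) - Re (\<phi> x))) * t" for t
    proof -
      have "Re (cinner z (t *\<^sub>R x)) = t * Re (cinner x z)"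
        using Re_cinner_commute[of z "t *\<^sub>R x"] by (simp add: cinner_scaleR_left)
      then show ?thesis
        using min[of "z + t *\<^sub>R x"]
        by (simp add: J_def norm_add_squared add scaleR power_mult_distrib algebra_simps)
    qed
    from linear_coefficient_zero[OF this] show ?thesis by simp
  qed
  \<comment> \<open>Multiplication by -i turns imaginary parts into real parts.\<close>
  have "Im (\<phi> x) = Im (cinner x z)" for x
    using Re_eq[of "(- \<i>) *\<^sub>C x"] by (simp add: homogeneous cinner_scaleC_left)
  with Re_eq have "\<phi> x = cinner x z" for x
    by (simp add: complex_eq_iff)
  then show ?thesis by blast
qed

section \<open>Bounded operators and their adjoints\<close>

lemma bounded_operators_iff:
  "f \<in> bounded_operators \<longleftrightarrow> bounded_linear f \<and> (\<forall>c x. f (c *\<^sub>C x) = c *\<^sub>C f x)"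
  by (simp add: bounded_operators_def)

lemma bounded_linear_scaleC: "bounded_linear (\<lambda>x::'a::complex_inner. c *\<^sub>C x)"
  by (rule bounded_linear_intro[where K = "cmod c"])
    (simp_all add: scaleC_add_right scaleC_scaleR norm_scaleC mult.commute)

lemma bounded_operators_scale: "f \<in> bounded_operators \<Longrightarrow> (\<lambda>x. c *\<^sub>C f x) \<in> bounded_operators"
  by (auto simp: bounded_operators_iff scaleC_scaleC mult.commute
      intro: bounded_linear_compose[OF bounded_linear_scaleC])

lemma bounded_operators_add:
  "f \<in> bounded_operators \<Longrightarrow> g \<in> bounded_operators \<Longrightarrow> (\<lambda>x. f x + g x) \<in> bounded_operators"
  by (auto simp: bounded_operators_iff scaleC_add_right intro: bounded_linear_add)

lemma bounded_operators_sum: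
  "(\<And>i. i \<in> A \<Longrightarrow> f i \<in> bounded_operators) \<Longrightarrow> (\<lambda>x. \<Sum>i\<in>A. f i x) \<in> bounded_operators"
  by (auto simp: bounded_operators_iff scaleC_sum_right intro: bounded_linear_sum)

lemma bounded_operators_id: "id \<in> bounded_operators"
  by (simp add: bounded_operators_iff id_def)

lemma bounded_operators_comp:
  "f \<in> bounded_operators \<Longrightarrow> g \<in> bounded_operators \<Longrightarrow> f \<circ> g \<in> bounded_operators"
  by (auto simp: bounded_operators_iff o_def intro: bounded_linear_compose)

text \<open>\<open>cadjoint\<close> is a definite description, so existence has to be supplied:
  Riesz gives a vector for each \<open>y\<close>, which is where completeness enters, and
  \<open>cadjoint_eqI\<close> identifies the resulting map.\<close>

lemma cinner_cadjoint:
  fixes f :: "'a::chilbert_space \<Rightarrow> 'a"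
  assumes f: "f \<in> bounded_operators"
  shows "cinner (f x) y = cinner x (cadjoint f y)"
proof -
  interpret bounded_linear f using f by (simp add: bounded_operators_iff)
  have "\<exists>z. \<forall>x. cinner (f x) y = cinner x z" for y
  proof (rule riesz_representation)
    show "bounded_linear (\<lambda>x. cinner (f x) y)"
    proof (rule bounded_linear_intro[where K = "onorm f * norm y"])
      fix x
      have "cmod (cinner (f x) y) \<le> norm (f x) * norm y"
        by (rule cmod_cinner_le)
      also have "\<dots> \<le> onorm f * norm x * norm y"
        by (intro mult_right_mono onorm bounded_linear_axioms) auto
      finally show "cmod (cinner (f x) y) \<le> norm x * (onorm f * norm y)"
        by (simp add: mult_ac)
    qed (simp_all add: add scaleR cinner_add_left cinner_scaleR_left scaleR_conv_of_real)
  qed (use f in \<open>simp add: bounded_operators_iff cinner_scaleC_left\<close>)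
  then obtain g where "cinner (f x) y = cinner x (g y)" for x y
    by metis
  with cadjoint_eqI show ?thesis by metis
qed

text \<open>Pair \<open>cadjoint f y\<close> with itself, move \<open>f\<close> across and cancel
  one factor. The arbitrary bound \<open>B\<close> lets explicit estimates pass to adjoints.\<close>

lemma norm_cadjoint_le:
  fixes f :: "'a::chilbert_space \<Rightarrow> 'a"
  assumes f: "f \<in> bounded_operators" and B: "\<And>x. norm (f x) \<le> B * norm x"
  shows "norm (cadjoint f y) \<le> B * norm y"
proof (cases "cadjoint f y = 0")
  case True
  have "0 \<le> B * norm y"
    using B[of y] norm_ge_zero order_trans by blast
  then show ?thesis by (simp add: True)
next
  case False
  have "(norm (cadjoint f y))\<^sup>2 = Re (cinner (f (cadjoint f y)) y)"
    by (simp add: cinner_cadjoint[OF f] Re_cinner_self)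
  also have "\<dots> \<le> B * norm (cadjoint f y) * norm y"
    by (intro order_trans[OF Re_cinner_le] mult_right_mono B) auto
  finally show ?thesis
    using False by (simp add: power2_eq_square mult_ac)
qed

lemma cadjoint_bounded_operators:
  fixes f :: "'a::chilbert_space \<Rightarrow> 'a"
  assumes f: "f \<in> bounded_operators"
  shows "cadjoint f \<in> bounded_operators"
proof -
  note adj = cinner_cadjoint[OF f, symmetric]
  have "bounded_linear f" using f by (simp add: bounded_operators_iff)
  then have onorm_f: "norm (f x) \<le> onorm f * norm x" for x by (rule onorm)
  have scale: "cadjoint f (c *\<^sub>C y) = c *\<^sub>C cadjoint f y" for c y
    by (rule cinner_eqI) (simp add: adj cinner_scaleC_right)
  have "bounded_linear (cadjoint f)"
  proof (rule bounded_linear_intro[where K = "onorm f"])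
    show "cadjoint f (x + y) = cadjoint f x + cadjoint f y" for x y
      by (rule cinner_eqI) (simp add: adj cinner_add_right)
    show "cadjoint f (r *\<^sub>R x) = r *\<^sub>R cadjoint f x" for r x
      using scale[of "complex_of_real r" x] by (simp add: scaleC_of_real)
    show "norm (cadjoint f x) \<le> norm x * onorm f" for x
      using norm_cadjoint_le[OF f onorm_f] by (simp add: mult.commute)
  qed
  with scale show ?thesis by (simp add: bounded_operators_iff)
qed

section \<open>Homogeneous sums over words\<close>

lemma finite_words: "finite {\<alpha> :: 'n::finite list. length \<alpha> = k}"
  using finite_lists_length_eq[of "UNIV :: 'n set" k] by simp

text \<open>A word splits uniquely at position \<open>p\<close>.\<close>

lemma sum_words_append:
  fixes f :: "'n::finite list \<Rightarrow> 'b::comm_monoid_add"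
  shows "(\<Sum>\<gamma> | length \<gamma> = p + q. f \<gamma>) = (\<Sum>\<alpha> | length \<alpha> = p. \<Sum>\<beta> | length \<beta> = q. f (\<alpha> @ \<beta>))"
proof -
  have "bij_betw (\<lambda>(\<alpha>, \<beta>). \<alpha> @ \<beta>) ({\<alpha>. length \<alpha> = p} \<times> {\<beta>. length \<beta> = q})
      {\<gamma> :: 'n list. length \<gamma> = p + q}"
    by (rule bij_betw_byWitness[where f' = "\<lambda>\<gamma>. (take p \<gamma>, drop p \<gamma>)"]) auto
  from sum.reindex_bij_betw[OF this, of f] show ?thesis
    by (simp add: sum.cartesian_product split_beta)
qed

lemma sum_words_Suc:
  fixes f :: "'n::finite list \<Rightarrow> 'b::comm_monoid_add"
  shows "(\<Sum>\<gamma> | length \<gamma> = Suc q. f \<gamma>) = (\<Sum>i\<in>UNIV. \<Sum>\<beta> | length \<beta> = q. f (i # \<beta>))"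
proof -
  have "bij_betw (\<lambda>i::'n. [i]) UNIV {\<alpha>. length \<alpha> = 1}"
    by (rule bij_betw_byWitness[where f' = hd]) (auto simp: length_Suc_conv)
  from sum.reindex_bij_betw[OF this, of "\<lambda>\<alpha>. \<Sum>\<beta> | length \<beta> = q. f (\<alpha> @ \<beta>)"] show ?thesis
    using sum_words_append[where f = f and p = 1 and q = q] by simp
qed

section \<open>Norm bounds for rows of operator monomials\<close>

lemma op_word_bounded_operators:
  "(\<And>i. T i \<in> bounded_operators) \<Longrightarrow> op_word T \<alpha> \<in> bounded_operators"
  by (induction \<alpha>) (auto intro: bounded_operators_comp bounded_operators_id)

lemma homogeneous_sum_bounded_operators:
  "(\<And>\<alpha>. V \<alpha> \<in> bounded_operators) \<Longrightarrow> homogeneous_sum k c V \<in> bounded_operators"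
  unfolding homogeneous_sum_def by (intro bounded_operators_sum bounded_operators_scale)

text \<open>The row sending a family \<open>x i\<close> to the sum of the \<open>T i (x i)\<close>
  has as adjoint the column with entries \<open>cadjoint (T i) y\<close>. The squared norm of the
  column is the quadratic form of \<open>S\<close>, which the ball condition bounds; duality carries
  the bound to the row.\<close>

lemma norm_row_le:
  fixes T :: "'n::finite \<Rightarrow> 'a::chilbert_space \<Rightarrow> 'a"
  assumes T: "T \<in> row_ball r"
  shows "(norm (\<Sum>i\<in>UNIV. T i (x i)))\<^sup>2 \<le> r\<^sup>2 * (\<Sum>i\<in>UNIV. (norm (x i))\<^sup>2)"
proof -
  define S where "S = (\<lambda>x. \<Sum>i\<in>UNIV. T i (cadjoint (T i) x))"
  define y where "y = (\<Sum>i\<in>UNIV. T i (x i))"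
  have T_bd: "T i \<in> bounded_operators" for i
    using T by (simp add: row_ball_def)
  note adj = cinner_cadjoint[OF T_bd]
  have "S \<in> bounded_operators"
    unfolding S_def
    using bounded_operators_sum[of UNIV "\<lambda>i. T i \<circ> cadjoint (T i)"]
    by (simp add: bounded_operators_comp T_bd cadjoint_bounded_operators)
  then have S: "bounded_linear S" by (simp add: bounded_operators_iff)
  have "sqrt (onorm S) \<le> r"
    using T by (simp add: row_ball_def S_def)
  then have "onorm S \<le> r\<^sup>2"
    using onorm_pos_le[OF S] by (simp add: sqrt_le_D)
  have "(\<Sum>i\<in>UNIV. (norm (cadjoint (T i) y))\<^sup>2) = Re (cinner (S y) y)"
    by (simp add: S_def cinner_sum_left adj Re_cinner_self)
  also have "\<dots> \<le> norm (S y) * norm y"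
    by (rule Re_cinner_le)
  also have "\<dots> \<le> onorm S * norm y * norm y"
    by (intro mult_right_mono onorm S) auto
  also have "\<dots> \<le> r\<^sup>2 * norm y * norm y"
    by (intro mult_right_mono \<open>onorm S \<le> r\<^sup>2\<close>) auto
  finally have *: "(\<Sum>i\<in>UNIV. (norm (cadjoint (T i) y))\<^sup>2) \<le> r\<^sup>2 * (norm y)\<^sup>2"
    by (simp add: power2_eq_square mult_ac)
  have "(norm y)\<^sup>2 = Re (cinner (\<Sum>i\<in>UNIV. T i (x i)) y)"
    by (simp add: y_def Re_cinner_self)
  also have "\<dots> = (\<Sum>i\<in>UNIV. Re (cinner (x i) (cadjoint (T i) y)))"
    by (simp add: cinner_sum_left adj)
  \<comment> \<open>Cauchy-Schwarz twice: in the Hilbert space for each \<open>i\<close>, then over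
    the index set.\<close>
  also have "\<dots> \<le> (\<Sum>i\<in>UNIV. \<bar>norm (x i)\<bar> * \<bar>norm (cadjoint (T i) y)\<bar>)"
    using Re_cinner_le by (intro sum_mono) auto
  also have "\<dots> \<le> L2_set (\<lambda>i. norm (x i)) UNIV * L2_set (\<lambda>i. norm (cadjoint (T i) y)) UNIV"
    by (rule L2_set_mult_ineq)
  finally have "(norm y)\<^sup>2 \<le> L2_set (\<lambda>i. norm (x i)) UNIV * L2_set (\<lambda>i. norm (cadjoint (T i) y)) UNIV" .
  then have "((norm y)\<^sup>2)\<^sup>2 \<le> (L2_set (\<lambda>i. norm (x i)) UNIV * L2_set (\<lambda>i. norm (cadjoint (T i) y)) UNIV)\<^sup>2"
    by (intro power_mono) auto
  also have "\<dots> = (\<Sum>i\<in>UNIV. (norm (x i))\<^sup>2) * (\<Sum>i\<in>UNIV. (norm (cadjoint (T i) y))\<^sup>2)"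
    by (simp add: power_mult_distrib L2_set_def sum_nonneg)
  also have "\<dots> \<le> (\<Sum>i\<in>UNIV. (norm (x i))\<^sup>2) * (r\<^sup>2 * (norm y)\<^sup>2)"
    by (intro mult_left_mono * sum_nonneg) auto
  finally have "(norm y)\<^sup>2 * (norm y)\<^sup>2 \<le> (r\<^sup>2 * (\<Sum>i\<in>UNIV. (norm (x i))\<^sup>2)) * (norm y)\<^sup>2"
    by (simp add: power2_eq_square mult_ac)
  \<comment> \<open>The factor \<open>(norm y)\<^sup>2\<close> cancels unless \<open>y = 0\<close>,
    where the bound is trivial.\<close>
  then show ?thesis
    unfolding y_def[symmetric]
    by (cases "y = 0") (simp add: sum_nonneg, metis mult_le_cancel_right_pos zero_less_norm_iff zero_less_power)
qed

text \<open>Peeling off the first letter writes the sum as the row of the \<open>T i\<close> applied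
  to sums over shorter words. Each \<open>i\<close> has its own family
  \<open>x (i # \<beta>)\<close>, hence the arbitrary \<open>x\<close> in the induction.\<close>

lemma norm_op_words_le:
  fixes T :: "'n::finite \<Rightarrow> 'a::chilbert_space \<Rightarrow> 'a"
  assumes T: "T \<in> row_ball r"
  shows "(norm (\<Sum>\<alpha> | length \<alpha> = k. op_word T \<alpha> (x \<alpha>)))\<^sup>2
    \<le> (r ^ k)\<^sup>2 * (\<Sum>\<alpha> | length \<alpha> = k. (norm (x \<alpha>))\<^sup>2)"
proof (induction k arbitrary: x)
  case 0
  then show ?case by simp
next
  case (Suc k)
  have T_bd: "bounded_linear (T i)" for i
    using T by (simp add: row_ball_def bounded_operators_iff)
  have "(\<Sum>\<alpha> | length \<alpha> = Suc k. op_word T \<alpha> (x \<alpha>)) =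
      (\<Sum>i\<in>UNIV. T i (\<Sum>\<beta> | length \<beta> = k. op_word T \<beta> (x (i # \<beta>))))"
    by (simp add: sum_words_Suc linear_sum bounded_linear.linear[OF T_bd])
  then have "(norm (\<Sum>\<alpha> | length \<alpha> = Suc k. op_word T \<alpha> (x \<alpha>)))\<^sup>2
      \<le> r\<^sup>2 * (\<Sum>i\<in>UNIV. (norm (\<Sum>\<beta> | length \<beta> = k. op_word T \<beta> (x (i # \<beta>))))\<^sup>2)"
    by (simp add: norm_row_le[OF T])
  also have "\<dots> \<le> r\<^sup>2 * (\<Sum>i\<in>UNIV. (r ^ k)\<^sup>2 * (\<Sum>\<beta> | length \<beta> = k. (norm (x (i # \<beta>)))\<^sup>2))"
    by (intro mult_left_mono sum_mono Suc.IH) auto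
  also have "\<dots> = (r ^ Suc k)\<^sup>2 * (\<Sum>\<alpha> | length \<alpha> = Suc k. (norm (x \<alpha>))\<^sup>2)"
    by (simp add: sum_words_Suc sum_distrib_left power_mult_distrib mult.assoc)
  finally show ?case .
qed

text \<open>The row of monomials is applied to the vectors
  \<open>c \<alpha> *\<^sub>C x\<close>.\<close>

lemma norm_homogeneous_sum_le:
  fixes T :: "'n::finite \<Rightarrow> 'a::chilbert_space \<Rightarrow> 'a"
  assumes T: "T \<in> row_ball r" and r: "0 \<le> r"
  shows "norm (homogeneous_sum k c (op_word T) x)
    \<le> r ^ k * sqrt (\<Sum>\<alpha> | length \<alpha> = k. (cmod (c \<alpha>))\<^sup>2) * norm x"
proof -
  have T_bd: "op_word T \<alpha> \<in> bounded_operators" for \<alpha>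
    using T by (intro op_word_bounded_operators) (simp add: row_ball_def)
  have "homogeneous_sum k c (op_word T) x = (\<Sum>\<alpha> | length \<alpha> = k. op_word T \<alpha> (c \<alpha> *\<^sub>C x))"
    using T_bd by (simp add: homogeneous_sum_def bounded_operators_iff)
  then have "(norm (homogeneous_sum k c (op_word T) x))\<^sup>2
      \<le> (r ^ k)\<^sup>2 * (\<Sum>\<alpha> | length \<alpha> = k. (norm (c \<alpha> *\<^sub>C x))\<^sup>2)"
    by (simp add: norm_op_words_le[OF T])
  also have "\<dots> = (r ^ k * sqrt (\<Sum>\<alpha> | length \<alpha> = k. (cmod (c \<alpha>))\<^sup>2) * norm x)\<^sup>2"
    by (simp add: norm_scaleC power_mult_distrib sum_distrib_right sum_nonneg mult.assoc)
  finally show ?thesis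
    by (rule power2_le_imp_le) (simp add: r sum_nonneg)
qed

lemma cinner_homogeneous_sum_cadjoint:
  fixes V :: "'n::finite list \<Rightarrow> 'a::chilbert_space \<Rightarrow> 'a"
  assumes "\<And>\<alpha>. V \<alpha> \<in> bounded_operators"
  shows "cinner (homogeneous_sum k c V x) y
    = cinner x (homogeneous_sum k (\<lambda>\<alpha>. cnj (c \<alpha>)) (\<lambda>\<alpha>. cadjoint (V \<alpha>)) y)"
  by (simp add: homogeneous_sum_def cinner_sum_left cinner_sum_right cinner_scaleC_left
      cinner_scaleC_right cinner_cadjoint[OF assms])

text \<open>The second sum is the adjoint of the first, and norm bounds pass to adjoints.\<close>

lemma onorm_homogeneous_sum_le:
  fixes T :: "'n::finite \<Rightarrow> 'a::chilbert_space \<Rightarrow> 'a"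
  assumes T: "T \<in> row_ball r" and r: "0 \<le> r"
  shows "onorm (homogeneous_sum k c (op_word T))
      \<le> r ^ k * sqrt (\<Sum>\<alpha> | length \<alpha> = k. (cmod (c \<alpha>))\<^sup>2)" (is "_ \<le> ?B")
    and "onorm (homogeneous_sum k (\<lambda>\<alpha>. cnj (c \<alpha>)) (\<lambda>\<alpha>. cadjoint (op_word T \<alpha>)))
      \<le> r ^ k * sqrt (\<Sum>\<alpha> | length \<alpha> = k. (cmod (c \<alpha>))\<^sup>2)"
proof -
  have B: "0 \<le> ?B"
    by (simp add: r sum_nonneg)
  note bound = norm_homogeneous_sum_le[OF T r, of k c]
  show "onorm (homogeneous_sum k c (op_word T)) \<le> ?B"
    using B bound by (rule onorm_bound)
  have T_bd: "op_word T \<alpha> \<in> bounded_operators" for \<alpha>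
    using T by (intro op_word_bounded_operators) (simp add: row_ball_def)
  have "cadjoint (homogeneous_sum k c (op_word T))
      = homogeneous_sum k (\<lambda>\<alpha>. cnj (c \<alpha>)) (\<lambda>\<alpha>. cadjoint (op_word T \<alpha>))"
    by (intro cadjoint_eqI cinner_homogeneous_sum_cadjoint T_bd)
  then show "onorm (homogeneous_sum k (\<lambda>\<alpha>. cnj (c \<alpha>)) (\<lambda>\<alpha>. cadjoint (op_word T \<alpha>))) \<le> ?B"
    using norm_cadjoint_le[OF homogeneous_sum_bounded_operators[OF T_bd] bound] B
    by (metis onorm_bound)
qed

text \<open>Expanding the power of the sum without collecting equal products gives one term per
  word.\<close>

lemma sum_scalar_word_squared:
  fixes r :: "'n::finite \<Rightarrow> real"
  shows "(\<Sum>\<alpha> | length \<alpha> = k. (scalar_word r \<alpha>)\<^sup>2) = (\<Sum>i\<in>UNIV. (r i)\<^sup>2) ^ k"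
proof (induction k)
  case 0
  then show ?case by (simp add: scalar_word_def)
next
  case (Suc k)
  have "scalar_word r (i # \<beta>) = r i * scalar_word r \<beta>" for i \<beta>
    by (simp add: scalar_word_def)
  then show ?case
    by (simp add: sum_words_Suc power_mult_distrib sum_distrib_right Suc flip: sum_distrib_left)
qed

text \<open>Scalar counterpart of the operator bound, by Cauchy-Schwarz over the words of length
  \<open>k\<close>.\<close>

lemma sum_scalar_word_le:
  fixes r :: "'n::finite \<Rightarrow> real"
  assumes "sqrt (\<Sum>i\<in>UNIV. (r i)\<^sup>2) \<le> s"
  shows "(\<Sum>\<alpha> | length \<alpha> = k. cmod (a \<alpha>) * scalar_word r \<alpha>)
    \<le> s ^ k * sqrt (\<Sum>\<alpha> | length \<alpha> = k. (cmod (a \<alpha>))\<^sup>2)"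
proof -
  have "(\<Sum>\<alpha> | length \<alpha> = k. cmod (a \<alpha>) * scalar_word r \<alpha>)
      \<le> (\<Sum>\<alpha> | length \<alpha> = k. \<bar>cmod (a \<alpha>)\<bar> * \<bar>scalar_word r \<alpha>\<bar>)"
    by (intro sum_mono) (simp add: mult_left_mono)
  also have "\<dots> \<le> L2_set (\<lambda>\<alpha>. cmod (a \<alpha>)) {\<alpha>. length \<alpha> = k} * L2_set (scalar_word r) {\<alpha>. length \<alpha> = k}"
    by (rule L2_set_mult_ineq)
  also have "L2_set (scalar_word r) {\<alpha>. length \<alpha> = k} = sqrt (\<Sum>i\<in>UNIV. (r i)\<^sup>2) ^ k"
    by (simp add: L2_set_def sum_scalar_word_squared real_sqrt_power)
  also have "L2_set (\<lambda>\<alpha>. cmod (a \<alpha>)) {\<alpha>. length \<alpha> = k} * sqrt (\<Sum>i\<in>UNIV. (r i)\<^sup>2) ^ k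
      \<le> L2_set (\<lambda>\<alpha>. cmod (a \<alpha>)) {\<alpha>. length \<alpha> = k} * s ^ k"
    by (intro mult_left_mono power_mono assms) (auto simp: sum_nonneg)
  finally show ?thesis
    by (simp add: L2_set_def mult.commute)
qed

section \<open>The polynomials of the constants\<close>

lemma cos_pi_over_ge_half: "1 / 2 \<le> cos (pi / (real (Suc d) + 2))"
proof -
  have "cos (pi / 3) \<le> cos (pi / (real (Suc d) + 2))"
    by (intro cos_monotone_0_pi_le frac_le) auto
  then show ?thesis by (simp only: cos_60)
qed

lemma cos_pi_over_mono: "d \<le> e \<Longrightarrow> cos (pi / (real d + 2)) \<le> cos (pi / (real e + 2))"
  by (intro cos_monotone_0_pi_le frac_le) (auto simp: pos_divide_le_eq)

text \<open>The quotient is at least 1, so the angle is at most pi/3. In particular all coefficients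
  are positive.\<close>

lemma cos_poly_coeff_ge_half:
  assumes "k \<in> {1..p-1}"
  shows "1 / 2 \<le> cos (pi / (real ((p - 1) div k) + 2))"
proof -
  have "(p - 1) div k > 0"
    using assms by (simp add: div_greater_zero_iff)
  then show ?thesis
    using cos_pi_over_ge_half by (metis Suc_pred)
qed

lemma cos_poly_strict_mono:
  assumes "2 \<le> p" "0 \<le> s" "s < t"
  shows "cos_poly p s < cos_poly p t"
  unfolding cos_poly_def
proof (rule sum_strict_mono)
  fix k assume k: "k \<in> {1..p-1}"
  then have "s ^ k < t ^ k"
    using assms by (intro power_strict_mono) auto
  then show "s ^ k * cos (pi / (real ((p - 1) div k) + 2)) < t ^ k * cos (pi / (real ((p - 1) div k) + 2))"
    using cos_poly_coeff_ge_half[OF k] by (intro mult_strict_right_mono) auto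
qed (use assms in auto)

lemma cos_poly_less_imp_less:
  assumes "2 \<le> p" "0 \<le> t" "cos_poly p s < cos_poly p t"
  shows "s < t"
proof (rule ccontr)
  assume "\<not> s < t"
  then consider "s = t" | "t < s" by linarith
  then show False
    using cos_poly_strict_mono[OF assms(1,2), of s] assms(3) by cases simp_all
qed

text \<open>Keep only the linear term. This brackets solutions from above.\<close>

lemma cos_poly_ge_half:
  assumes "2 \<le> p" "0 \<le> t"
  shows "t / 2 \<le> cos_poly p t"
proof -
  have "1 / 2 \<le> cos (pi / (real ((p - 1) div 1) + 2))"
    using assms(1) by (intro cos_poly_coeff_ge_half) simp
  from mult_left_mono[OF this assms(2)]
  have "t / 2 \<le> t ^ 1 * cos (pi / (real ((p - 1) div 1) + 2))"
    by simp
  also have "\<dots> \<le> cos_poly p t"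
    unfolding cos_poly_def
  proof (rule member_le_sum[of 1 "{1..p-1}" "\<lambda>k. t ^ k * cos (pi / (real ((p - 1) div k) + 2))"])
    fix k assume "k \<in> {1..p-1} - {1}"
    then show "0 \<le> t ^ k * cos (pi / (real ((p - 1) div k) + 2))"
      using cos_poly_coeff_ge_half[of k p] assms(2) by (intro mult_nonneg_nonneg) auto
  next
    show "1 \<in> {1..p-1}"
      using assms(1) by simp
  qed simp
  finally show ?thesis .
qed

section \<open>Solutions of \<open>cos_poly p t = y\<close> and their dependence on
  \<open>p\<close>\<close>

lemma cos_poly_zero: "cos_poly p 0 = 0"
  unfolding cos_poly_def by (rule sum.neutral) auto

lemma cos_poly_ex1:
  assumes "2 \<le> p" "0 < y"
  shows "\<exists>!t. 0 < t \<and> cos_poly p t = y"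
proof (rule ex_ex1I)
  \<comment> \<open>The right end \<open>2 * y\<close> of the bracket comes from
    \<open>cos_poly_ge_half\<close>.\<close>
  have "\<exists>t\<ge>0. t \<le> 2 * y \<and> cos_poly p t = y"
  proof (rule IVT')
    show "cos_poly p 0 \<le> y"
      using assms(2) by (simp add: cos_poly_zero)
    show "y \<le> cos_poly p (2 * y)"
      using cos_poly_ge_half[of p "2 * y"] assms by simp
    show "continuous_on {0..2 * y} (cos_poly p)"
      unfolding cos_poly_def by (intro continuous_intros)
  qed (use assms(2) in simp)
  then obtain t where t: "0 \<le> t" "cos_poly p t = y"
    by blast
  then have "t \<noteq> 0"
    using assms(2) cos_poly_zero by auto
  with t show "\<exists>t. 0 < t \<and> cos_poly p t = y"
    by (intro exI[of _ t]) simp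
  show "s = t" if "0 < s \<and> cos_poly p s = y" "0 < t \<and> cos_poly p t = y" for s t
    using that cos_poly_strict_mono[OF assms(1), of s t] cos_poly_strict_mono[OF assms(1), of t s]
    by (cases s t rule: linorder_cases) simp_all
qed

text \<open>Raising \<open>p\<close> does not decrease the quotients, hence the cosines, and adds a
  positive term of degree \<open>p\<close>.\<close>

lemma cos_poly_less_Suc:
  assumes "2 \<le> p" "0 < t"
  shows "cos_poly p t < cos_poly (Suc p) t"
proof -
  have "cos_poly p t \<le> (\<Sum>k=1..p-1. t ^ k * cos (pi / (real (p div k) + 2)))"
    unfolding cos_poly_def
    by (intro sum_mono mult_left_mono cos_pi_over_mono div_le_mono) (use assms in auto)
  also have "\<dots> < \<dots> + t ^ p * cos (pi / (real (p div p) + 2))"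
    using cos_pi_over_ge_half[of 0] assms by (auto intro!: mult_pos_pos)
  also have "\<dots> = cos_poly (Suc p) t"
    using assms sum.cl_ivl_Suc[of "\<lambda>k. t ^ k * cos (pi / (real (p div k) + 2))" 1 "p - 1"]
    by (simp add: cos_poly_def)
  finally show ?thesis .
qed

text \<open>At \<open>s p\<close> the next polynomial already exceeds \<open>y\<close>, so its
  solution lies strictly to the left. The general level \<open>y\<close> covers both
  constants.\<close>

lemma cos_poly_solution_strict_antimono:
  assumes s: "\<And>p. 2 \<le> p \<Longrightarrow> 0 < s p \<and> cos_poly p (s p) = y"
  shows "strict_antimono_on {2..} s"
proof -
  have step: "s (Suc p) < s p" if "2 \<le> p" for p
    using cos_poly_less_Suc[of p "s p"] cos_poly_less_imp_less[of "Suc p" "s p" "s (Suc p)"]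
      s[of p] s[of "Suc p"] that by auto
  have "s q < s p" if "p < q" "2 \<le> p" for p q
    using that(1)
  proof (induction q)
    case (Suc q)
    show ?case
    proof (cases "p = q")
      case True
      then show ?thesis using step that(2) by simp
    next
      case False
      then have "s q < s p"
        using Suc by simp
      moreover have "s (Suc q) < s q"
        using Suc.prems that(2) by (intro step) simp
      ultimately show ?thesis by simp
    qed
  qed simp
  then show ?thesis
    by (simp add: monotone_on_def)
qed

text \<open>Cosines are at most 1, so a truncated geometric series dominates.\<close>

lemma cos_poly_less_geometric:
  assumes "0 < t" "t < 1"
  shows "cos_poly p t < t / (1 - t)"
proof -
  have "cos_poly p t \<le> (\<Sum>k=1..p-1. t ^ k)"
    unfolding cos_poly_def using assms by (intro sum_mono mult_left_le) auto
  also have "\<dots> < t / (1 - t)"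
  proof (cases "p - 1")
    case (Suc q)
    have "(\<Sum>k=1..Suc q. t ^ k) = (t - t ^ Suc (Suc q)) / (1 - t)"
      using assms by (subst sum_gp) auto
    also have "\<dots> < t / (1 - t)"
      using assms by (intro divide_strict_right_mono) auto
    finally show ?thesis by (simp only: Suc)
  qed (use assms in simp)
  finally show ?thesis .
qed

text \<open>For fixed \<open>k\<close> the coefficient tends to \<open>cos 0 = 1\<close> as
  \<open>p\<close> grows, so the full geometric sum is approached from below.\<close>

lemma cos_poly_tendsto_lower:
  assumes t: "0 < t" "t < 1" and y: "y < t / (1 - t)"
  shows "\<forall>\<^sub>F p in sequentially. y < cos_poly p t"
proof -
  have "(\<lambda>K. (t - t ^ Suc K) / (1 - t)) \<longlonglongrightarrow> (t - 0) / (1 - t)"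
    using t by (intro tendsto_intros LIMSEQ_Suc LIMSEQ_realpow_zero) auto
  then have "\<forall>\<^sub>F K in sequentially. y < (t - t ^ Suc K) / (1 - t)"
    using y by (simp add: order_tendstoD(1))
  \<comment> \<open>Freeze a partial sum that already exceeds \<open>y\<close> before letting
    \<open>p\<close> grow.\<close>
  then obtain K where "y < (t - t ^ Suc K) / (1 - t)"
    by (meson eventually_happens trivial_limit_sequentially)
  also have "\<dots> = (\<Sum>k=1..K. t ^ k * cos 0)"
    using t by (subst cos_zero, simp, subst sum_gp) auto
  finally have K: "y < (\<Sum>k=1..K. t ^ k * cos 0)" .
  have "(\<lambda>p. pi / (real ((p - 1) div k) + 2)) \<longlonglongrightarrow> 0" if "k \<in> {1..K}" for k
  proof (rule tendsto_sandwich[OF always_eventually _ tendsto_const])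
    show "(\<lambda>p. pi * real k * (1 / real p)) \<longlonglongrightarrow> 0"
      using tendsto_mult_left[OF lim_1_over_n, of "pi * real k"] by simp
    show "\<forall>\<^sub>F p in sequentially. pi / (real ((p - 1) div k) + 2) \<le> pi * real k * (1 / real p)"
      using eventually_gt_at_top[of 0]
    proof eventually_elim
      case (elim p)
      \<comment> \<open>The remainder is less than \<open>k\<close>, so the quotient grows like p/k
        and the angle is at most pi k/p.\<close>
      have "p \<le> k * ((p - 1) div k + 2)"
        using that dividend_less_times_div[of k "p - 1"] by (simp add: algebra_simps)
      then have "real p \<le> real k * (real ((p - 1) div k) + 2)"
        by (metis of_nat_add of_nat_le_iff of_nat_mult of_nat_numeral)
      then show "pi / (real ((p - 1) div k) + 2) \<le> pi * real k * (1 / real p)"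
        using elim mult_left_mono[of "real p" "real k * (real ((p - 1) div k) + 2)" pi]
        by (simp add: field_simps)
    qed
  qed auto
  then have "(\<lambda>p. \<Sum>k=1..K. t ^ k * cos (pi / (real ((p - 1) div k) + 2)))
      \<longlonglongrightarrow> (\<Sum>k=1..K. t ^ k * cos 0)"
    by (intro tendsto_intros) auto
  from order_tendstoD(1)[OF this K]
  have "\<forall>\<^sub>F p in sequentially. y < (\<Sum>k=1..K. t ^ k * cos (pi / (real ((p - 1) div k) + 2)))" .
  then show ?thesis
    using eventually_gt_at_top[of K]
  proof eventually_elim
    case (elim p)
    note elim(1)
    also have "(\<Sum>k=1..K. t ^ k * cos (pi / (real ((p - 1) div k) + 2))) \<le> cos_poly p t"
      unfolding cos_poly_def
    proof (rule sum_mono2)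
      fix k assume "k \<in> {1..p-1} - {1..K}"
      then show "0 \<le> t ^ k * cos (pi / (real ((p - 1) div k) + 2))"
        using cos_poly_coeff_ge_half[of k p] t by (intro mult_nonneg_nonneg) auto
    qed (use elim in auto)
    finally show ?case .
  qed
qed

text \<open>\<open>y / (1 + y)\<close> solves the limiting equation t/(1 - t) = y; it is 1/2 for
  \<open>y = 1\<close> and 1/3 for \<open>y = 1/2\<close>.\<close>

lemma cos_poly_solution_tendsto:
  assumes s: "\<And>p. 2 \<le> p \<Longrightarrow> 0 < s p \<and> cos_poly p (s p) = y" and y: "0 < y"
  shows "s \<longlonglongrightarrow> y / (1 + y)"
proof (rule order_tendstoI)
  fix l assume l: "l < y / (1 + y)"
  \<comment> \<open>The polynomial stays below \<open>y\<close> at the limit point, so every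
    solution lies to its right.\<close>
  have "l < s p" if p: "2 \<le> p" for p
  proof -
    have "y / (1 + y) / (1 - y / (1 + y)) = y"
      using y by (simp add: field_simps)
    have "cos_poly p (y / (1 + y)) < cos_poly p (s p)"
      using cos_poly_less_geometric[of "y / (1 + y)" p] y s[OF p]
      by (simp only: \<open>y / (1 + y) / (1 - y / (1 + y)) = y\<close>) simp
    then have "y / (1 + y) < s p"
      using cos_poly_less_imp_less[OF p] s[OF p] by simp
    with l show ?thesis by simp
  qed
  then show "\<forall>\<^sub>F p in sequentially. l < s p"
    by (rule eventually_sequentiallyI)
next
  fix u assume u: "y / (1 + y) < u"
  have "y / (1 + y) < 1" "0 < y / (1 + y)"
    using y by auto
  then have "y / (1 + y) < min u 1"
    using u by simp
  \<comment> \<open>A point strictly between the limit and \<open>u\<close>, kept below 1 so that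
    the geometric series converges; there the polynomials eventually exceed
    \<open>y\<close>.\<close>
  then obtain t where t: "y / (1 + y) < t" "t < min u 1"
    using dense by blast
  then have t: "y / (1 + y) < t" "t < 1" "t \<le> u"
    by simp_all
  with \<open>0 < y / (1 + y)\<close> have "0 < t" by linarith
  have "y < t * (1 + y)"
    using t(1) y by (simp add: pos_divide_less_eq)
  then have "y < t / (1 - t)"
    using t(2) by (simp add: pos_less_divide_eq algebra_simps)
  from cos_poly_tendsto_lower[OF \<open>0 < t\<close> t(2) this]
  show "\<forall>\<^sub>F p in sequentially. s p < u"
    using eventually_ge_at_top[of 2]
  proof eventually_elim
    case (elim p)
    then have "s p < t"
      using cos_poly_less_imp_less[of p t "s p"] s[of p] \<open>0 < t\<close> by simp
    with t(3) show ?case by simp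
  qed
qed

section \<open>The two constants as solutions at the levels 1 and 1/2\<close>

lemma gamma_const:
  assumes "2 \<le> p"
  shows "0 < gamma_const p" "cos_poly p (gamma_const p) = 1"
proof -
  have "0 < gamma_const p \<and> cos_poly p (gamma_const p) = 1"
    unfolding gamma_const_def by (rule theI'[OF cos_poly_ex1[OF assms]]) simp
  then show "0 < gamma_const p" "cos_poly p (gamma_const p) = 1"
    by blast+
qed

text \<open>At \<open>t = 1\<close> the terms \<open>k = 1\<close> and \<open>k = 2\<close>
  contribute at least 1/2 each, so the level 1 is reached by then.\<close>

lemma gamma_const_le_1:
  assumes "3 \<le> p"
  shows "gamma_const p \<le> 1"
proof -
  have "{1, 2} \<subseteq> {1..p-1}"
    using assms by auto
  then have "(\<Sum>k\<in>{1, 2}. 1 ^ k * cos (pi / (real ((p - 1) div k) + 2))) \<le> cos_poly p 1"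
    unfolding cos_poly_def
  proof (intro sum_mono2)
    fix k assume "k \<in> {1..p-1} - {1, 2}"
    then show "0 \<le> 1 ^ k * cos (pi / (real ((p - 1) div k) + 2))"
      using cos_poly_coeff_ge_half[of k p] by simp
  qed (use assms in auto)
  moreover have "1 / 2 \<le> cos (pi / (real ((p - 1) div 1) + 2))" "1 / 2 \<le> cos (pi / (real ((p - 1) div 2) + 2))"
    using assms by (intro cos_poly_coeff_ge_half; simp)+
  ultimately have "1 \<le> cos_poly p 1" by simp
  show ?thesis
  proof (rule ccontr)
    assume "\<not> gamma_const p \<le> 1"
    then have "cos_poly p 1 < cos_poly p (gamma_const p)"
      using assms by (intro cos_poly_strict_mono) auto
    with \<open>1 \<le> cos_poly p 1\<close> gamma_const(2)[of p] assms show False by simp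
  qed
qed

text \<open>Since \<open>cos_poly p 1\<close> is at least 1/2, every solution satisfies
  \<open>t \<le> 1\<close>, and \<open>cos_poly_ex1\<close> applies.\<close>

lemma t_const_ex1:
  assumes "2 \<le> p"
  shows "\<exists>!t. 0 < t \<and> t \<le> 1 \<and> cos_poly p t = 1 / 2"
proof -
  have "t \<le> 1" if "cos_poly p t = 1 / 2" for t
  proof (rule ccontr)
    assume "\<not> t \<le> 1"
    then have "cos_poly p 1 < cos_poly p t"
      using assms by (intro cos_poly_strict_mono) auto
    with cos_poly_ge_half[of p 1] that assms show False by simp
  qed
  then have "(0 < t \<and> t \<le> 1 \<and> cos_poly p t = 1 / 2) \<longleftrightarrow> (0 < t \<and> cos_poly p t = 1 / 2)" for t
    by blast
  then show ?thesis
    using cos_poly_ex1[OF assms, of "1 / 2"] by (simp only:)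
qed

lemma t_const:
  assumes "2 \<le> p"
  shows "0 < t_const p" "t_const p \<le> 1" "cos_poly p (t_const p) = 1 / 2"
proof -
  have "0 < t_const p \<and> t_const p \<le> 1 \<and> cos_poly p (t_const p) = 1 / 2"
    unfolding t_const_def by (rule theI'[OF t_const_ex1[OF assms]])
  then show "0 < t_const p" "t_const p \<le> 1" "cos_poly p (t_const p) = 1 / 2"
    by blast+
qed

section \<open>Fejer's inequality\<close>

lemma sum_power_root_of_unity:
  fixes z :: "'a::field"
  assumes "z ^ N = 1" "z \<noteq> 1"
  shows "(\<Sum>s<N. z ^ s) = 0"
  using geometric_sum[of z N] assms by simp

text \<open>The nodes are the \<open>N\<close>-th roots of \<open>-1\<close>.\<close>

lemma sum_node_power:
  assumes "0 < l" "l < N"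
  shows "(\<Sum>s<N. cis (real (2 * s + 1) * pi / real N) ^ l) = 0"
proof -
  \<comment> \<open>The node powers form a geometric progression whose ratio \<open>z\<close> is an
    \<open>N\<close>-th root of unity.\<close>
  define z where "z = cis (2 * pi * real l / real N)"
  have node: "cis (real (2 * s + 1) * pi / real N) ^ l = cis (pi * real l / real N) * z ^ s" for s
    by (simp add: z_def Complex.DeMoivre cis_mult algebra_simps add_divide_distrib)
  have "z ^ N = cis (2 * pi * real l)"
    using assms by (simp add: z_def Complex.DeMoivre)
  also have "\<dots> = 1"
    by (rule cis_multiple_2pi) simp
  finally have "z ^ N = 1" .
  \<comment> \<open>Otherwise \<open>N\<close> would divide \<open>l\<close>.\<close>
  moreover have "z \<noteq> 1"
  proof
    assume "z = 1"
    then have "cos (2 * pi * real l / real N) = 1"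
      by (simp add: z_def complex_eq_iff)
    then obtain x :: int where "2 * pi * real l / real N = of_int x * 2 * pi"
      by (auto simp: cos_one_2pi_int)
    then have "real l = of_int x * real N"
      using assms by (simp add: field_simps)
    then have "int l = x * int N"
      by (metis of_int_eq_iff of_int_mult of_int_of_nat_eq)
    then have "int N dvd int l"
      by simp
    then show False
      using assms by (auto dest: dvd_imp_le)
  qed
  ultimately have "(\<Sum>s<N. z ^ s) = 0"
    by (rule sum_power_root_of_unity)
  then show ?thesis
    unfolding node by (simp flip: sum_distrib_left)
qed

text \<open>The node angles are odd multiples of pi/N, so none is closer than pi/N to a multiple of
  2 pi. This makes the weights in \<open>fejer_inequality\<close> nonnegative.\<close>

lemma cos_node_le:
  assumes "s < N"
  shows "cos (real (2 * s + 1) * pi / real N) \<le> cos (pi / real N)"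
proof (cases "real (2 * s + 1) \<le> real N")
  case True
  have "pi / real N \<le> real (2 * s + 1) * pi / real N"
    by (intro divide_right_mono) (auto simp: algebra_simps)
  moreover have "real (2 * s + 1) * pi / real N \<le> pi"
    using mult_right_mono[OF True, of pi] assms by (simp add: pos_divide_le_eq mult.commute)
  ultimately show ?thesis
    by (intro cos_monotone_0_pi_le) auto
next
  case False
  have "real (2 * s + 2) \<le> 2 * real N"
    using assms by linarith
  \<comment> \<open>Past the half turn the angle is reflected to 2 pi minus itself;
    \<open>s < N\<close> keeps the multiple of pi/N at least 1.\<close>
  have "pi / real N \<le> (2 * real N - real (2 * s + 1)) * pi / real N"
  proof (rule divide_right_mono)
    show "pi \<le> (2 * real N - real (2 * s + 1)) * pi"
      using mult_right_mono[of 1 "2 * real N - real (2 * s + 1)" pi] \<open>real (2 * s + 2) \<le> 2 * real N\<close> by simp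
  qed simp
  also have eq: "(2 * real N - real (2 * s + 1)) * pi / real N = 2 * pi - real (2 * s + 1) * pi / real N"
    using assms by (simp add: field_simps)
  finally have "pi / real N \<le> 2 * pi - real (2 * s + 1) * pi / real N" .
  moreover have "2 * pi - real (2 * s + 1) * pi / real N \<le> pi"
    unfolding eq[symmetric]
    using False assms mult_right_mono[of "2 * real N - real (2 * s + 1)" "real N" pi]
    by (simp add: pos_divide_le_eq mult.commute)
  ultimately have "cos (2 * pi - real (2 * s + 1) * pi / real N) \<le> cos (pi / real N)"
    by (intro cos_monotone_0_pi_le) auto
  then show ?thesis
    by (simp add: cos_diff)
qed

lemma Re_of_real_mult: "Re (complex_of_real r * z) = r * Re z"
  by simp

text \<open>
  Averaging over the nodes with the nonnegative weights \<open>cos (\<pi> / N) - cos \<theta>\<close>, \<open>N = d + 2\<close>,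
  annihilates the frequencies \<open>2, \<dots>, d\<close>.
\<close>

lemma fejer_inequality:
  fixes B :: "nat \<Rightarrow> complex"
  assumes nonneg: "\<And>z. cmod z = 1 \<Longrightarrow> 0 \<le> c + 2 * Re (\<Sum>l=1..d. B l * z ^ l)"
    and d: "1 \<le> d"
  shows "Re (B 1) \<le> c * cos (pi / (real d + 2))"
proof -
  define N where "N = d + 2"
  define C where "C = cos (pi / real N)"
  define z where "z s = cis (real (2 * s + 1) * pi / real N)" for s
  define E where "E l = (\<Sum>s<N. z s ^ l)" for l
  have E: "E l = 0" if "0 < l" "l < N" for l
    unfolding E_def z_def by (rule sum_node_power[OF that])
  have E0: "E 0 = of_nat N"
    by (simp add: E_def)
  have z: "cmod (z s) = 1" "z s * cnj (z s) = 1" for s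
    by (simp_all add: z_def cis_cnj cis_mult)
  \<comment> \<open>On the unit circle, multiplication by \<open>Re z\<close> averages the two
    neighbouring exponents; \<open>Suc l\<close> keeps the lower one natural.\<close>
  have weight: "(\<Sum>s<N. complex_of_real (C - Re (z s)) * z s ^ Suc l)
      = C * E (Suc l) - (E (Suc (Suc l)) + E l) / 2" for l
  proof -
    have "complex_of_real (C - Re (z s)) * z s ^ Suc l
        = C * z s ^ Suc l - (z s ^ Suc (Suc l) + z s ^ l) / 2" for s
    proof -
      have "complex_of_real (Re (z s)) = (z s + cnj (z s)) / 2"
        by (simp add: complex_add_cnj)
      moreover have "cnj (z s) * z s ^ Suc l = z s ^ l"
        using z(2)[of s] by (simp add: mult_ac)
      ultimately show ?thesis
        by (simp add: algebra_simps diff_divide_distrib add_divide_distrib)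
    qed
    then show ?thesis
      by (simp add: E_def sum_subtractf sum.distrib sum_distrib_left flip: sum_divide_distrib)
  qed
  \<comment> \<open>Of the exponents 0, 1, 2 only 0 survives; \<open>2 < N\<close> because
    \<open>1 \<le> d\<close>.\<close>
  have weight_1: "(\<Sum>s<N. complex_of_real (C - Re (z s)) * z s ^ 1) = - of_nat N / 2"
    unfolding One_nat_def weight using E[of "Suc 0"] E[of "Suc (Suc 0)"] d by (simp add: E0 N_def field_simps)
  \<comment> \<open>The exponents l - 1, l and l + 1 all lie strictly between 0 and
    \<open>N = d + 2\<close>.\<close>
  have weight_l: "(\<Sum>s<N. complex_of_real (C - Re (z s)) * z s ^ l) = 0" if "l \<in> {1..d} - {1}" for l
  proof -
    have "l = Suc (l - 1)" "0 < l - 1"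
      using that by auto
    then obtain l' where l': "l = Suc l'" "0 < l'"
      by blast
    show ?thesis
      unfolding l' weight using E[of "Suc l'"] E[of "Suc (Suc l')"] E[of l'] that l' by (simp add: N_def)
  qed
  have "0 \<le> (\<Sum>s<N. (C - Re (z s)) * (c + 2 * Re (\<Sum>l=1..d. B l * z s ^ l)))"
    using cos_node_le[of _ N]
    by (intro sum_nonneg mult_nonneg_nonneg nonneg z) (simp add: z_def C_def)
  also have "\<dots> = c * (\<Sum>s<N. C - Re (z s))
      + 2 * Re (\<Sum>s<N. \<Sum>l=1..d. B l * (complex_of_real (C - Re (z s)) * z s ^ l))"
  proof -
    have "(C - Re (z s)) * (c + 2 * Re (\<Sum>l=1..d. B l * z s ^ l)) = c * (C - Re (z s))
        + 2 * Re (\<Sum>l=1..d. B l * (complex_of_real (C - Re (z s)) * z s ^ l))" for s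
    proof -
      have "(\<Sum>l=1..d. B l * (complex_of_real (C - Re (z s)) * z s ^ l))
          = complex_of_real (C - Re (z s)) * (\<Sum>l=1..d. B l * z s ^ l)"
        by (simp add: sum_distrib_left mult_ac)
      then show ?thesis
        by (simp only: Re_of_real_mult algebra_simps)
    qed
    then show ?thesis
      by (simp add: sum.distrib sum_distrib_left)
  qed
  \<comment> \<open>The real parts of the nodes sum to the real part of
    \<open>E 1 = 0\<close>.\<close>
  also have "(\<Sum>s<N. C - Re (z s)) = real N * C"
    using E[of 1] by (simp add: E_def N_def sum_subtractf flip: Re_sum)
  also have "(\<Sum>s<N. \<Sum>l=1..d. B l * (complex_of_real (C - Re (z s)) * z s ^ l))
      = (\<Sum>l=1..d. B l * (\<Sum>s<N. complex_of_real (C - Re (z s)) * z s ^ l))"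
    unfolding sum_distrib_left by (rule sum.swap)
  also have "\<dots> = B 1 * (\<Sum>s<N. complex_of_real (C - Re (z s)) * z s ^ 1)
      + (\<Sum>l\<in>{1..d} - {1}. B l * (\<Sum>s<N. complex_of_real (C - Re (z s)) * z s ^ l))"
    using d by (intro sum.remove) simp_all
  also have "(\<Sum>l\<in>{1..d} - {1}. B l * (\<Sum>s<N. complex_of_real (C - Re (z s)) * z s ^ l)) = 0"
    by (intro sum.neutral ballI) (simp only: weight_l mult_zero_right)
  finally have "0 \<le> real N * (c * C - Re (B 1))"
    unfolding weight_1 by (simp add: algebra_simps)
  then have "Re (B 1) \<le> c * C"
    by (simp add: N_def zero_le_mult_iff)
  then show ?thesis
    by (simp add: C_def N_def add.commute)
qed

text \<open>With f the polynomial, 1 + f and 1 - f are both nonnegative, and the smaller of 1 + c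
  and 1 - c is 1 - |c|.\<close>

lemma fejer_inequality_abs:
  fixes B :: "nat \<Rightarrow> complex"
  assumes bound: "\<And>z. cmod z = 1 \<Longrightarrow> \<bar>c + 2 * Re (\<Sum>l=1..d. B l * z ^ l)\<bar> \<le> 1"
    and d: "1 \<le> d"
  shows "Re (B 1) \<le> (1 - \<bar>c\<bar>) * cos (pi / (real d + 2))"
proof -
  have "Re (B 1) \<le> (1 + c) * cos (pi / (real d + 2))"
    using bound by (intro fejer_inequality[OF _ d]) (fastforce simp: abs_le_iff)
  \<comment> \<open>Substituting -z in 1 - f restores the sign of the odd coefficients, so the first
    one is again \<open>B 1\<close>. It is left unsimplified to match the coefficient family at
    index 1.\<close>
  moreover have "Re (- ((-1) ^ 1 * B 1)) \<le> (1 - c) * cos (pi / (real d + 2))"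
  proof (rule fejer_inequality[OF _ d])
    fix z :: complex assume "cmod z = 1"
    then have "c + 2 * Re (\<Sum>l=1..d. B l * (- z) ^ l) \<le> 1"
      using bound[of "- z"] by (simp only: norm_minus_cancel abs_le_iff)
    moreover have "(\<Sum>l=1..d. - ((-1) ^ l * B l) * z ^ l) = - (\<Sum>l=1..d. B l * (- z) ^ l)"
      by (simp add: sum_negf power_minus[of z] mult_ac)
    ultimately show "0 \<le> 1 - c + 2 * Re (\<Sum>l=1..d. - ((-1) ^ l * B l) * z ^ l)"
      by simp
  qed
  ultimately show ?thesis
    by (cases "0 \<le> c") auto
qed

section \<open>Test vectors on the free semigroup\<close>

definition free_word :: "'n list \<Rightarrow> 'n free_group" where
  "free_word \<alpha> = foldr (\<lambda>i \<sigma>. generator i * \<sigma>) \<alpha> 1"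

text \<open>Positive letters never cancel; hence distinct words give distinct group elements and
  orthogonal basis vectors.\<close>

lemma Rep_free_word: "Rep_free_group (free_word \<alpha>) = map (Pair True) \<alpha>"
proof (induction \<alpha>)
  case Nil
  then show ?case by (simp add: free_word_def one_free_group.rep_eq)
next
  case (Cons i \<alpha>)
  have "Rep_free_group (free_word (i # \<alpha>)) = cons_letter (True, i) (Rep_free_group (free_word \<alpha>))"
    by (simp add: free_word_def times_free_group.rep_eq generator.rep_eq)
  also have "\<dots> = map (Pair True) (i # \<alpha>)"
    unfolding Cons by (cases \<alpha>) (auto simp: inv_letter_def)
  finally show ?case .
qed

lemma free_word_eq_iff: "free_word \<alpha> = free_word \<beta> \<longleftrightarrow> \<alpha> = \<beta>"
proof
  assume "free_word \<alpha> = free_word \<beta>"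
  then have "map (Pair True) \<alpha> = map (Pair True) \<beta>"
    by (metis Rep_free_word)
  then show "\<alpha> = \<beta>"
    by (simp add: inj_map_eq_map inj_on_def)
qed simp

lemma cinner_ket: "cinner (ket \<sigma>) (ket \<tau>) = (if \<sigma> = \<tau> then 1 else 0)"
proof -
  have "cinner (ket \<sigma>) (ket \<tau>) = (\<Sum>\<^sub>\<infinity>x. if x = \<sigma> then if \<sigma> = \<tau> then 1 else 0 else 0)"
    unfolding cinner_ell2.rep_eq ket.rep_eq by (rule infsum_cong) auto
  also have "\<dots> = (\<Sum>\<^sub>\<infinity>x\<in>{\<sigma>}. if \<sigma> = \<tau> then 1 else 0)"
    by (rule infsum_cong_neutral) auto
  finally show ?thesis by simp
qed

lemma op_word_unitary_ket: "op_word unitary \<alpha> (ket (free_word \<beta>)) = ket (free_word (\<alpha> @ \<beta>))"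
  by (induction \<alpha>) (simp_all add: unitary_ket free_word_def)

lemma op_word_unitary_bounded: "op_word unitary \<alpha> \<in> bounded_operators"
  by (intro op_word_bounded_operators unitary_bounded)

section \<open>Block vectors and their superpositions\<close>

primrec block_weight :: "('n list \<Rightarrow> complex) \<Rightarrow> nat \<Rightarrow> nat \<Rightarrow> 'n list \<Rightarrow> complex" where
  "block_weight u k 0 \<beta> = 1"
| "block_weight u k (Suc j) \<beta> = u (take k \<beta>) * block_weight u k j (drop k \<beta>)"

text \<open>The first \<open>l\<close> factors read exactly the letters of
  \<open>\<alpha>\<close>.\<close>

lemma block_weight_append:
  "length \<alpha> = l * k \<Longrightarrow> block_weight u k (l + j) (\<alpha> @ \<beta>) = block_weight u k l \<alpha> * block_weight u k j \<beta>"
  by (induction l arbitrary: \<alpha>) simp_all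

text \<open>The sum factors over the blocks, each contributing 1; this makes the block vectors unit
  vectors.\<close>

lemma sum_block_weight:
  fixes u :: "'n::finite list \<Rightarrow> complex"
  assumes "(\<Sum>\<alpha> | length \<alpha> = k. (cmod (u \<alpha>))\<^sup>2) = 1"
  shows "(\<Sum>\<beta> | length \<beta> = j * k. (cmod (block_weight u k j \<beta>))\<^sup>2) = 1"
proof (induction j)
  case (Suc j)
  have "(\<Sum>\<beta> | length \<beta> = k + j * k. (cmod (block_weight u k (Suc j) \<beta>))\<^sup>2)
      = (\<Sum>\<alpha> | length \<alpha> = k. \<Sum>\<beta> | length \<beta> = j * k. (cmod (u \<alpha>))\<^sup>2 * (cmod (block_weight u k j \<beta>))\<^sup>2)"
    unfolding sum_words_append by (intro sum.cong refl) (simp add: norm_mult power_mult_distrib)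
  then show ?case
    by (simp add: Suc assms flip: sum_distrib_left)
qed simp

definition block_vector :: "('n::finite list \<Rightarrow> complex) \<Rightarrow> nat \<Rightarrow> nat \<Rightarrow> 'n free_group ell2" where
  "block_vector u k j = (\<Sum>\<beta> | length \<beta> = j * k. block_weight u k j \<beta> *\<^sub>C ket (free_word \<beta>))"

lemma op_word_block_vector:
  "op_word unitary \<alpha> (block_vector u k j)
    = (\<Sum>\<beta> | length \<beta> = j * k. block_weight u k j \<beta> *\<^sub>C ket (free_word (\<alpha> @ \<beta>)))"
proof -
  have "linear (op_word unitary \<alpha> :: 'a free_group ell2 \<Rightarrow> _)"
    and "op_word unitary \<alpha> (c *\<^sub>C x) = c *\<^sub>C op_word unitary \<alpha> x" for c and x :: "'a free_group ell2"
    using op_word_unitary_bounded[of \<alpha>] by (auto simp: bounded_operators_iff bounded_linear.linear)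
  then show ?thesis
    by (simp add: block_vector_def linear_sum op_word_unitary_ket)
qed

text \<open>Only pairs \<open>\<gamma> = \<alpha> @ \<beta>\<close> contribute. The weight then
  splits, and summing over \<open>\<beta>\<close> removes its part. The entry depends on
  \<open>j - i\<close> alone, as in a Toeplitz matrix.\<close>

lemma cinner_op_word_block_vector:
  fixes u :: "'n::finite list \<Rightarrow> complex"
  assumes u: "(\<Sum>\<alpha> | length \<alpha> = k. (cmod (u \<alpha>))\<^sup>2) = 1" and k: "0 < k"
  shows "cinner (op_word unitary \<alpha> (block_vector u k i)) (block_vector u k j)
    = (if length \<alpha> + i * k = j * k then cnj (block_weight u k (j - i) \<alpha>) else 0)"
proof -
  have "cinner (op_word unitary \<alpha> (block_vector u k i)) (block_vector u k j)
      = (\<Sum>\<beta> | length \<beta> = i * k. \<Sum>\<gamma> | length \<gamma> = j * k.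
          if \<alpha> @ \<beta> = \<gamma> then block_weight u k i \<beta> * cnj (block_weight u k j \<gamma>) else 0)"
    unfolding op_word_block_vector block_vector_def[of u k j] cinner_sum_left
    unfolding cinner_sum_right
    by (intro sum.cong refl)
      (simp add: cinner_scaleC_left cinner_scaleC_right cinner_ket free_word_eq_iff)
  also have "\<dots> = (\<Sum>\<beta> | length \<beta> = i * k. if length \<alpha> + i * k = j * k
      then block_weight u k i \<beta> * cnj (block_weight u k j (\<alpha> @ \<beta>)) else 0)"
    by (intro sum.cong refl) (simp add: finite_words sum.delta')
  also have "\<dots> = (if length \<alpha> + i * k = j * k then cnj (block_weight u k (j - i) \<alpha>) else 0)"
  proof (cases "length \<alpha> + i * k = j * k")
    case True
    then have "i * k \<le> j * k" by linarith
    then have "i \<le> j" using k by simp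
    have len: "length \<alpha> = (j - i) * k"
      unfolding diff_mult_distrib using True by linarith
    have "block_weight u k i \<beta> * cnj (block_weight u k j (\<alpha> @ \<beta>))
        = cnj (block_weight u k (j - i) \<alpha>) * complex_of_real ((cmod (block_weight u k i \<beta>))\<^sup>2)" for \<beta>
      using block_weight_append[OF len, of u i \<beta>] \<open>i \<le> j\<close>
      by (simp only: complex_norm_square) simp
    then have "(\<Sum>\<beta> | length \<beta> = i * k. block_weight u k i \<beta> * cnj (block_weight u k j (\<alpha> @ \<beta>)))
        = cnj (block_weight u k (j - i) \<alpha>)
          * complex_of_real (\<Sum>\<beta> | length \<beta> = i * k. (cmod (block_weight u k i \<beta>))\<^sup>2)"
      by (simp add: sum_distrib_left)
    then show ?thesis
      using True by (simp add: sum_block_weight[OF u])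
  qed simp
  finally show ?thesis .
qed

text \<open>A truncated character: on a Toeplitz form it evaluates, up to boundary terms,
  \<open>L\<close> times a trigonometric polynomial.\<close>

definition test_vector :: "('n::finite list \<Rightarrow> complex) \<Rightarrow> nat \<Rightarrow> complex \<Rightarrow> nat \<Rightarrow> 'n free_group ell2" where
  "test_vector u k z L = (\<Sum>j<L. z ^ j *\<^sub>C block_vector u k j)"

lemma op_word_test_vector:
  "op_word unitary \<alpha> (test_vector u k z L) = (\<Sum>j<L. z ^ j *\<^sub>C op_word unitary \<alpha> (block_vector u k j))"
proof -
  have "linear (op_word unitary \<alpha> :: 'a free_group ell2 \<Rightarrow> _)"
    and "op_word unitary \<alpha> (c *\<^sub>C x) = c *\<^sub>C op_word unitary \<alpha> x" for c and x :: "'a free_group ell2"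
    using op_word_unitary_bounded[of \<alpha>] by (auto simp: bounded_operators_iff bounded_linear.linear)
  then show ?thesis
    by (simp add: test_vector_def linear_sum)
qed

text \<open>A word of \<open>l\<close> blocks shifts the index by \<open>l\<close>, and
  \<open>L - l\<close> of the \<open>L\<close> indices stay in range; truncated subtraction gives 0
  when \<open>l\<close> exceeds \<open>L\<close>.\<close>

lemma cinner_op_word_test_vector:
  fixes u :: "'n::finite list \<Rightarrow> complex"
  assumes u: "(\<Sum>\<alpha> | length \<alpha> = k. (cmod (u \<alpha>))\<^sup>2) = 1" and k: "0 < k" and z: "cmod z = 1"
  shows "length \<alpha> = l * k \<Longrightarrow> cinner (op_word unitary \<alpha> (test_vector u k z L)) (test_vector u k z L)
      = of_nat (L - l) * cnj z ^ l * cnj (block_weight u k l \<alpha>)"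
    and "\<not> k dvd length \<alpha> \<Longrightarrow> cinner (op_word unitary \<alpha> (test_vector u k z L)) (test_vector u k z L) = 0"
proof -
  have expand: "cinner (op_word unitary \<alpha> (test_vector u k z L)) (test_vector u k z L)
      = (\<Sum>i<L. \<Sum>j<L. z ^ i * cnj z ^ j *
          (if length \<alpha> + i * k = j * k then cnj (block_weight u k (j - i) \<alpha>) else 0))"
    unfolding op_word_test_vector
    unfolding test_vector_def cinner_sum_left
    unfolding cinner_sum_right
    by (intro sum.cong refl)
      (simp add: cinner_scaleC_left cinner_scaleC_right cinner_op_word_block_vector[OF u k])
  {
    assume len: "length \<alpha> = l * k"
    have zz: "z ^ i * cnj z ^ i = 1" for i
      using z complex_norm_square[of z] by (simp flip: power_mult_distrib)
    have "(\<Sum>j<L. z ^ i * cnj z ^ j *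
          (if length \<alpha> + i * k = j * k then cnj (block_weight u k (j - i) \<alpha>) else 0))
        = (if i < L - l then cnj z ^ l * cnj (block_weight u k l \<alpha>) else 0)" for i
    proof -
      have "length \<alpha> + i * k = j * k \<longleftrightarrow> l + i = j" for j
        using k by (simp add: len flip: add_mult_distrib)
      then have "(\<Sum>j<L. z ^ i * cnj z ^ j *
          (if length \<alpha> + i * k = j * k then cnj (block_weight u k (j - i) \<alpha>) else 0))
          = (\<Sum>j<L. if l + i = j then z ^ i * cnj z ^ j * cnj (block_weight u k (j - i) \<alpha>) else 0)"
        by (intro sum.cong refl) simp
      also have "\<dots> = (if l + i < L then z ^ i * cnj z ^ i * (cnj z ^ l * cnj (block_weight u k l \<alpha>)) else 0)"
        by (simp add: sum.delta' power_add mult_ac)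
      also have "l + i < L \<longleftrightarrow> i < L - l" by auto
      finally show ?thesis
        unfolding zz by simp
    qed
    then have "cinner (op_word unitary \<alpha> (test_vector u k z L)) (test_vector u k z L)
        = (\<Sum>i<L. if i < L - l then cnj z ^ l * cnj (block_weight u k l \<alpha>) else 0)"
      unfolding expand by simp
    also have "\<dots> = (\<Sum>i<L - l. cnj z ^ l * cnj (block_weight u k l \<alpha>))"
      by (rule sum.mono_neutral_cong_right) auto
    finally show "cinner (op_word unitary \<alpha> (test_vector u k z L)) (test_vector u k z L)
        = of_nat (L - l) * cnj z ^ l * cnj (block_weight u k l \<alpha>)"
      by (simp add: mult.assoc)
  next
    assume "\<not> k dvd length \<alpha>"
    then have "length \<alpha> + i * k \<noteq> j * k" for i j
      using dvd_add_left_iff[of k "i * k" "length \<alpha>"] by (metis dvd_triv_right)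
    then show "cinner (op_word unitary \<alpha> (test_vector u k z L)) (test_vector u k z L) = 0"
      unfolding expand by simp
  }
qed

lemma norm_test_vector:
  fixes u :: "'n::finite list \<Rightarrow> complex"
  assumes "(\<Sum>\<alpha> | length \<alpha> = k. (cmod (u \<alpha>))\<^sup>2) = 1" "0 < k" "cmod z = 1"
  shows "(norm (test_vector u k z L))\<^sup>2 = real L"
proof -
  have "cinner (test_vector u k z L) (test_vector u k z L) = of_nat L"
    using cinner_op_word_test_vector(1)[OF assms, of "[]" 0 L] by simp
  then show ?thesis
    by (metis Re_cinner_self complex.sel(1) of_real_of_nat_eq Re_complex_of_real)
qed

section \<open>The quadratic form of \<open>Hpoly\<close>\<close>

lemma homogeneous_sum_unitary_bounded: "homogeneous_sum k a (op_word unitary) \<in> bounded_operators"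
  by (intro homogeneous_sum_bounded_operators op_word_unitary_bounded)

lemma Hpoly_bounded: "Hpoly m a \<in> bounded_operators"
proof -
  have "(\<lambda>x. a [] *\<^sub>C x) \<in> bounded_operators"
    using bounded_operators_scale[OF bounded_operators_id] by simp
  moreover have "(\<lambda>x. \<Sum>k=1..m-1. homogeneous_sum k (\<lambda>\<alpha>. cnj (a \<alpha>)) (\<lambda>\<alpha>. cadjoint (op_word unitary \<alpha>)) x)
      \<in> bounded_operators"
    by (intro bounded_operators_sum homogeneous_sum_bounded_operators
        cadjoint_bounded_operators op_word_unitary_bounded)
  moreover have "(\<lambda>x. \<Sum>k=1..m-1. homogeneous_sum k a (op_word unitary) x) \<in> bounded_operators"
    by (intro bounded_operators_sum homogeneous_sum_unitary_bounded)
  ultimately show ?thesis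
    unfolding Hpoly_def by (intro bounded_operators_add)
qed

text \<open>The adjoint half contributes the complex conjugate of the other half.\<close>

lemma cinner_Hpoly:
  "cinner (Hpoly m a x) x = a [] * complex_of_real ((norm x)\<^sup>2)
    + complex_of_real (2 * Re (\<Sum>p=1..m-1. cinner (homogeneous_sum p a (op_word unitary) x) x))"
proof -
  have "cinner (homogeneous_sum p (\<lambda>\<alpha>. cnj (a \<alpha>)) (\<lambda>\<alpha>. cadjoint (op_word unitary \<alpha>)) x) x
      = cnj (cinner (homogeneous_sum p a (op_word unitary) x) x)" for p
    by (subst cinner_commute)
      (simp only: cinner_homogeneous_sum_cadjoint[OF op_word_unitary_bounded, where k = p and c = a])
  then have "cinner (Hpoly m a x) x = a [] * complex_of_real ((norm x)\<^sup>2)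
    + ((\<Sum>p=1..m-1. cinner (homogeneous_sum p a (op_word unitary) x) x)
       + cnj (\<Sum>p=1..m-1. cinner (homogeneous_sum p a (op_word unitary) x) x))"
    by (simp add: Hpoly_def cinner_add_left cinner_sum_left cinner_scaleC_left cinner_self)
  then show ?thesis
    by (simp only: complex_add_cnj)
qed

text \<open>The quadratic form of a selfadjoint operator is real, and the nonconstant part is real
  already; the unit vector \<open>ket 1\<close> isolates the constant.\<close>

lemma Hpoly_constant_real:
  assumes "cadjoint (Hpoly m a) = Hpoly m a"
  shows "a [] = complex_of_real (Re (a []))"
proof -
  define x :: "'a free_group ell2" where "x = ket 1"
  have "(norm x)\<^sup>2 = 1"
    using Re_cinner_self[of x] by (simp add: x_def cinner_ket)
  have "cinner (Hpoly m a x) x = cnj (cinner (Hpoly m a x) x)"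
    unfolding cinner_commute[of x "Hpoly m a x", symmetric]
    by (simp only: cinner_cadjoint[OF Hpoly_bounded] assms)
  then have "Im (cinner (Hpoly m a x) x) = 0"
    by (simp add: complex_eq_iff)
  then have "Im (a []) = 0"
    unfolding cinner_Hpoly by (simp add: \<open>(norm x)\<^sup>2 = 1\<close>)
  then show ?thesis by (simp add: complex_eq_iff)
qed

text \<open>Normalising \<open>a\<close> gives equality in Cauchy-Schwarz.\<close>

lemma exists_unit_dual_vector:
  fixes a :: "'b \<Rightarrow> complex"
  assumes A: "finite A" "A \<noteq> {}"
  shows "\<exists>u. (\<Sum>\<alpha>\<in>A. (cmod (u \<alpha>))\<^sup>2) = 1 \<and>
    (\<Sum>\<alpha>\<in>A. a \<alpha> * cnj (u \<alpha>)) = complex_of_real (sqrt (\<Sum>\<alpha>\<in>A. (cmod (a \<alpha>))\<^sup>2))"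
proof -
  define s where "s = sqrt (\<Sum>\<alpha>\<in>A. (cmod (a \<alpha>))\<^sup>2)"
  have s2: "s\<^sup>2 = (\<Sum>\<alpha>\<in>A. (cmod (a \<alpha>))\<^sup>2)"
    by (simp add: s_def sum_nonneg)
  show ?thesis
  proof (cases "s = 0")
    case True
    then have a: "a \<alpha> = 0" if "\<alpha> \<in> A" for \<alpha>
      using s2 that A by (simp add: sum_nonneg_eq_0_iff)
    \<comment> \<open>For \<open>a = 0\<close> on \<open>A\<close> any unit vector will do; a point
      mass is taken.\<close>
    obtain \<beta> where "\<beta> \<in> A" using A by blast
    then show ?thesis
      using A True a by (intro exI[of _ "\<lambda>\<alpha>. if \<alpha> = \<beta> then 1 else 0"])
        (simp add: s_def if_distrib[of cmod] if_distrib[of "\<lambda>x. x ^ _"] cong: if_cong)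
  next
    case False
    have aa: "a \<alpha> * cnj (a \<alpha> / s) = complex_of_real ((cmod (a \<alpha>))\<^sup>2) / s" for \<alpha>
      by (simp only: complex_norm_square) simp
    have "(\<Sum>\<alpha>\<in>A. a \<alpha> * cnj (a \<alpha> / s)) = complex_of_real (s\<^sup>2) / s"
      unfolding s2 aa by (simp flip: sum_divide_distrib)
    moreover have "(\<Sum>\<alpha>\<in>A. (cmod (a \<alpha> / s))\<^sup>2) = s\<^sup>2 / s\<^sup>2"
      by (simp add: norm_divide power_divide s2 flip: sum_divide_distrib)
    moreover have "complex_of_real (s\<^sup>2) / s = s"
      using False by (simp add: power2_eq_square)
    ultimately show ?thesis
      using False unfolding s_def[symmetric] by (intro exI[of _ "\<lambda>\<alpha>. a \<alpha> / s"]) auto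
  qed
qed

text \<open>After division by \<open>L\<close> the boundary term \<open>g\<close> disappears in the
  limit.\<close>

lemma abs_le_of_linear_growth:
  fixes f g :: real
  assumes "\<And>L::nat. d \<le> L \<Longrightarrow> \<bar>real L * f - g\<bar> \<le> real L"
  shows "\<bar>f\<bar> \<le> 1"
proof (rule ccontr)
  assume "\<not> \<bar>f\<bar> \<le> 1"
  then obtain n :: nat where n: "\<bar>g\<bar> < real n * (\<bar>f\<bar> - 1)"
    using reals_Archimedean3[of "\<bar>f\<bar> - 1"] by auto
  define L where "L = max n d"
  have "real n * (\<bar>f\<bar> - 1) \<le> real L * (\<bar>f\<bar> - 1)"
    using \<open>\<not> \<bar>f\<bar> \<le> 1\<close> by (intro mult_right_mono) (auto simp: L_def)
  moreover have "real L * \<bar>f\<bar> - \<bar>g\<bar> \<le> \<bar>real L * f - g\<bar>"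
    using abs_triangle_ineq2[of "real L * f" g] by (simp add: abs_mult)
  ultimately show False
    using assms[of L] n by (simp add: L_def algebra_simps)
qed

text \<open>Only the lengths divisible by \<open>k\<close> survive the test, so the scalar
  polynomial has degree \<open>(m - 1) div k\<close>; this is the integer part in the
  cosine.\<close>

lemma Hpoly_coefficient_bound:
  fixes a :: "'n::finite list \<Rightarrow> complex"
  assumes adj: "cadjoint (Hpoly m a) = Hpoly m a" and norm: "onorm (Hpoly m a) \<le> 1"
    and k: "k \<in> {1..m-1}"
  shows "sqrt (\<Sum>\<alpha> | length \<alpha> = k. (cmod (a \<alpha>))\<^sup>2)
    \<le> (1 - cmod (a [])) * cos (pi / (real ((m - 1) div k) + 2))"
proof -
  define d where "d = (m - 1) div k"
  have d: "1 \<le> d" and "0 < k"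
    using k by (auto simp: d_def Suc_le_eq div_greater_zero_iff)
  define c where "c = Re (a [])"
  have c: "a [] = complex_of_real c"
    unfolding c_def by (rule Hpoly_constant_real[OF adj])
  have "replicate k undefined \<in> {\<alpha> :: 'n list. length \<alpha> = k}"
    by simp
  then obtain u where u: "(\<Sum>\<alpha> | length \<alpha> = k. (cmod (u \<alpha>))\<^sup>2) = 1"
    and au: "(\<Sum>\<alpha> | length \<alpha> = k. a \<alpha> * cnj (u \<alpha>)) = complex_of_real (sqrt (\<Sum>\<alpha> | length \<alpha> = k. (cmod (a \<alpha>))\<^sup>2))"
    using exists_unit_dual_vector[OF finite_words[of k], of a] by blast
  \<comment> \<open>For \<open>l = 1\<close> the block weight is \<open>u\<close> itself, so
    \<open>B 1\<close> is the norm to be bounded.\<close>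
  define B where "B l = (\<Sum>\<alpha> | length \<alpha> = l * k. a \<alpha> * cnj (block_weight u k l \<alpha>))" for l
  have B1: "B 1 = complex_of_real (sqrt (\<Sum>\<alpha> | length \<alpha> = k. (cmod (a \<alpha>))\<^sup>2))"
    by (simp add: B_def flip: au)
  \<comment> \<open>Using \<open>cnj z\<close> in the test vector yields powers of \<open>z\<close>.
    The subtracted sum is the boundary loss from \<open>L - l\<close>, where
    \<open>d \<le> L\<close> prevents truncation.\<close>
  have form: "Re (cinner (Hpoly m a (test_vector u k (cnj z) L)) (test_vector u k (cnj z) L))
      = real L * (c + 2 * Re (\<Sum>l=1..d. B l * z ^ l)) - 2 * Re (\<Sum>l=1..d. of_nat l * (B l * z ^ l))"
    if z: "cmod z = 1" and L: "d \<le> L" for z L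
  proof -
    define x where "x = test_vector u k (cnj z) L"
    have z': "cmod (cnj z) = 1" using z by simp
    define q where "q p = cinner (homogeneous_sum p a (op_word unitary) x) x" for p
    have q_sum: "q p = (\<Sum>\<alpha> | length \<alpha> = p. a \<alpha> * cinner (op_word unitary \<alpha> x) x)" for p
      by (simp add: q_def homogeneous_sum_def cinner_sum_left cinner_scaleC_left)
    have q0: "q p = 0" if "\<not> k dvd p" for p
      unfolding q_sum x_def
      using that cinner_op_word_test_vector(2)[OF u \<open>0 < k\<close> z'] by (intro sum.neutral) auto
    have ql: "q (l * k) = of_nat (L - l) * (B l * z ^ l)" for l
      unfolding q_sum x_def B_def sum_distrib_left sum_distrib_right
      by (intro sum.cong refl) (simp add: cinner_op_word_test_vector(1)[OF u \<open>0 < k\<close> z', of _ l])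
    \<comment> \<open>The multiples of \<open>k\<close> among the degrees are \<open>l * k\<close>
      with \<open>1 \<le> l \<le> d\<close>.\<close>
    have "(\<Sum>p=1..m-1. q p) = (\<Sum>p\<in>(\<lambda>l. l * k) ` {1..d}. q p)"
    proof (rule sum.mono_neutral_right)
      show "(\<lambda>l. l * k) ` {1..d} \<subseteq> {1..m-1}"
        using \<open>0 < k\<close> by (auto simp: d_def less_eq_div_iff_mult_less_eq Suc_le_eq)
      show "\<forall>p\<in>{1..m-1} - (\<lambda>l. l * k) ` {1..d}. q p = 0"
      proof
        fix p assume p: "p \<in> {1..m-1} - (\<lambda>l. l * k) ` {1..d}"
        have "\<not> k dvd p"
        proof
          assume "k dvd p"
          then obtain l where l: "p = l * k" by (metis dvd_def mult.commute)
          then have "l \<in> {1..d}"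
            using p \<open>0 < k\<close> by (auto simp: d_def less_eq_div_iff_mult_less_eq Suc_le_eq)
          with l p show False by blast
        qed
        then show "q p = 0" by (rule q0)
      qed
    qed simp
    also have "\<dots> = (\<Sum>l=1..d. q (l * k))"
      using \<open>0 < k\<close> by (subst sum.reindex) (auto simp: inj_on_def)
    also have "\<dots> = (\<Sum>l=1..d. of_nat L * (B l * z ^ l) - of_nat l * (B l * z ^ l))"
      unfolding ql using L by (intro sum.cong refl) (simp add: of_nat_diff left_diff_distrib)
    also have "\<dots> = of_real (real L) * (\<Sum>l=1..d. B l * z ^ l) - (\<Sum>l=1..d. of_nat l * (B l * z ^ l))"
      by (simp add: sum_subtractf sum_distrib_left)
    finally have "Re (\<Sum>p=1..m-1. q p)
        = real L * Re (\<Sum>l=1..d. B l * z ^ l) - Re (\<Sum>l=1..d. of_nat l * (B l * z ^ l))"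
      by (simp only: minus_complex.sel Re_of_real_mult)
    moreover have "(norm x)\<^sup>2 = real L"
      unfolding x_def by (rule norm_test_vector[OF u \<open>0 < k\<close> z'])
    ultimately show ?thesis
      unfolding x_def[symmetric] cinner_Hpoly q_def[symmetric] c
      by (simp only: plus_complex.sel Re_complex_of_real of_real_mult[symmetric]) (simp only: algebra_simps)
  qed
  have "\<bar>c + 2 * Re (\<Sum>l=1..d. B l * z ^ l)\<bar> \<le> 1" if z: "cmod z = 1" for z
  proof (rule abs_le_of_linear_growth)
    fix L assume L: "d \<le> L"
    define x where "x = test_vector u k (cnj z) L"
    have "\<bar>Re (cinner (Hpoly m a x) x)\<bar> \<le> norm (Hpoly m a x) * norm x"
      using abs_Re_le_cmod cmod_cinner_le order_trans by blast
    also have "\<dots> \<le> onorm (Hpoly m a) * norm x * norm x"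
      using Hpoly_bounded[of m a] by (intro mult_right_mono onorm) (auto simp: bounded_operators_iff)
    also have "\<dots> \<le> 1 * norm x * norm x"
      by (intro mult_right_mono norm) auto
    also have "\<dots> = real L"
      using norm_test_vector[OF u \<open>0 < k\<close>, of "cnj z" L] z by (simp add: x_def power2_eq_square)
    finally show "\<bar>real L * (c + 2 * Re (\<Sum>l=1..d. B l * z ^ l))
        - 2 * Re (\<Sum>l=1..d. of_nat l * (B l * z ^ l))\<bar> \<le> real L"
      unfolding x_def form[OF z L] .
  qed
  from fejer_inequality_abs[OF this d] show ?thesis
    by (simp only: B1 Re_complex_of_real c d_def norm_of_real)
qed

theorem corollary1p9:
  fixes m :: nat and a :: "'n::finite list \<Rightarrow> complex"
  assumes "m \<ge> 2"
    and "Hpoly m a \<in> Cstar_red"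
    and "cadjoint (Hpoly m a) = Hpoly m a"
    and "onorm (Hpoly m a) \<le> 1"
  shows
    "(\<forall>k\<in>{1..m-1}. sqrt (\<Sum>\<alpha> | length \<alpha> = k. (cmod (a \<alpha>))\<^sup>2)
        \<le> (1 - cmod (a [])) * cos (pi / (real ((m - 1) div k) + 2)))
   \<and> ((\<forall>T :: 'n \<Rightarrow> 'h::chilbert_space \<Rightarrow> 'h. T \<in> row_ball (gamma_const m) \<longrightarrow>
         (\<Sum>k=0..m-1. onorm (homogeneous_sum k (\<lambda>\<alpha>. complex_of_real (cmod (a \<alpha>))) (op_word T))) \<le> 1)
      \<and> (\<forall>p\<ge>2. \<exists>!t. 0 < t \<and> cos_poly p t = 1)
      \<and> (\<forall>p\<ge>2. 0 < gamma_const p \<and> cos_poly p (gamma_const p) = 1)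
      \<and> (\<forall>p\<ge>3. gamma_const p \<le> 1)
      \<and> strict_antimono_on {2..} gamma_const
      \<and> gamma_const \<longlonglongrightarrow> 1/2)
   \<and> ((\<forall>T :: 'n \<Rightarrow> 'h \<Rightarrow> 'h. T \<in> row_ball (t_const m) \<longrightarrow>
         (\<Sum>k=1..m-1. onorm (homogeneous_sum k (\<lambda>\<alpha>. complex_of_real (cmod (cnj (a \<alpha>))))
                              (\<lambda>\<alpha>. cadjoint (op_word T \<alpha>))))
         + cmod (a [])
         + (\<Sum>k=1..m-1. onorm (homogeneous_sum k (\<lambda>\<alpha>. complex_of_real (cmod (a \<alpha>))) (op_word T))) \<le> 1)
      \<and> (\<forall>p\<ge>2. \<exists>!t. 0 < t \<and> t \<le> 1 \<and> cos_poly p t = 1/2)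
      \<and> (\<forall>p\<ge>2. 0 < t_const p \<and> t_const p \<le> 1 \<and> cos_poly p (t_const p) = 1/2)
      \<and> strict_antimono_on {2..} t_const
      \<and> t_const \<longlonglongrightarrow> 1/3)
   \<and> (\<forall>r :: 'n \<Rightarrow> real. (\<forall>i. 0 \<le> r i) \<longrightarrow> sqrt (\<Sum>i\<in>UNIV. (r i)\<^sup>2) \<le> gamma_const m \<longrightarrow>
         (\<Sum>k=0..m-1. \<Sum>\<alpha> | length \<alpha> = k. cmod (a \<alpha>) * scalar_word r \<alpha>) \<le> 1)
   \<and> (\<forall>r :: 'n \<Rightarrow> real. (\<forall>i. 0 \<le> r i) \<longrightarrow> sqrt (\<Sum>i\<in>UNIV. (r i)\<^sup>2) \<le> t_const m \<longrightarrow>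
         cmod (a []) + 2 * (\<Sum>k=1..m-1. \<Sum>\<alpha> | length \<alpha> = k. cmod (a \<alpha>) * scalar_word r \<alpha>) \<le> 1)"
proof -
  define s where "s k = sqrt (\<Sum>\<alpha> | length \<alpha> = k. (cmod (a \<alpha>))\<^sup>2)" for k
  have coeff: "s k \<le> (1 - cmod (a [])) * cos (pi / (real ((m - 1) div k) + 2))" if "k \<in> {1..m-1}" for k
    unfolding s_def by (rule Hpoly_coefficient_bound[OF assms(3,4) that])
  have s0: "s 0 = cmod (a [])"
    by (simp add: s_def)
  have weighted: "(\<Sum>k=1..m-1. t ^ k * s k) \<le> (1 - cmod (a [])) * cos_poly m t" if "0 \<le> t" for t
  proof -
    have "(\<Sum>k=1..m-1. t ^ k * s k)
        \<le> (\<Sum>k=1..m-1. t ^ k * ((1 - cmod (a [])) * cos (pi / (real ((m - 1) div k) + 2))))"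
      using that by (intro sum_mono mult_left_mono coeff) auto
    then show ?thesis
      by (simp add: cos_poly_def sum_distrib_left mult_ac)
  qed
  \<comment> \<open>At level 1 the bound is |a_0| + (1 - |a_0|).\<close>
  have gamma_sum: "(\<Sum>k=0..m-1. gamma_const m ^ k * s k) \<le> 1"
    using weighted[of "gamma_const m"] gamma_const[OF assms(1)]
    by (simp add: sum.atLeast_Suc_atMost s0)
  \<comment> \<open>The level 1/2 compensates for counting the nonconstant part twice.\<close>
  have t_sum: "cmod (a []) + 2 * (\<Sum>k=1..m-1. t_const m ^ k * s k) \<le> 1"
    using weighted[of "t_const m"] t_const[OF assms(1)] by simp
  have ii: "(\<Sum>k=0..m-1. onorm (homogeneous_sum k (\<lambda>\<alpha>. complex_of_real (cmod (a \<alpha>))) (op_word T))) \<le> 1"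
    if T: "T \<in> row_ball (gamma_const m)" for T :: "'n \<Rightarrow> 'h \<Rightarrow> 'h"
  proof -
    have "(\<Sum>k=0..m-1. onorm (homogeneous_sum k (\<lambda>\<alpha>. complex_of_real (cmod (a \<alpha>))) (op_word T)))
        \<le> (\<Sum>k=0..m-1. gamma_const m ^ k * s k)"
      using onorm_homogeneous_sum_le(1)[OF T, of _ "\<lambda>\<alpha>. complex_of_real (cmod (a \<alpha>))"] gamma_const[OF assms(1)]
      by (intro sum_mono) (simp add: s_def)
    with gamma_sum show ?thesis by linarith
  qed
  have iii: "(\<Sum>k=1..m-1. onorm (homogeneous_sum k (\<lambda>\<alpha>. complex_of_real (cmod (cnj (a \<alpha>))))
                              (\<lambda>\<alpha>. cadjoint (op_word T \<alpha>))))
         + cmod (a [])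
         + (\<Sum>k=1..m-1. onorm (homogeneous_sum k (\<lambda>\<alpha>. complex_of_real (cmod (a \<alpha>))) (op_word T))) \<le> 1"
    if T: "T \<in> row_ball (t_const m)" for T :: "'n \<Rightarrow> 'h \<Rightarrow> 'h"
  proof -
    have "(\<Sum>k=1..m-1. onorm (homogeneous_sum k (\<lambda>\<alpha>. complex_of_real (cmod (cnj (a \<alpha>))))
          (\<lambda>\<alpha>. cadjoint (op_word T \<alpha>)))) \<le> (\<Sum>k=1..m-1. t_const m ^ k * s k)"
      using onorm_homogeneous_sum_le(2)[OF T, of _ "\<lambda>\<alpha>. complex_of_real (cmod (a \<alpha>))"] t_const[OF assms(1)]
      by (intro sum_mono) (simp add: s_def)
    moreover have "(\<Sum>k=1..m-1. onorm (homogeneous_sum k (\<lambda>\<alpha>. complex_of_real (cmod (a \<alpha>))) (op_word T)))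
        \<le> (\<Sum>k=1..m-1. t_const m ^ k * s k)"
      using onorm_homogeneous_sum_le(1)[OF T, of _ "\<lambda>\<alpha>. complex_of_real (cmod (a \<alpha>))"] t_const[OF assms(1)]
      by (intro sum_mono) (simp add: s_def)
    ultimately show ?thesis
      using t_sum by linarith
  qed
  have iv: "(\<Sum>k=0..m-1. \<Sum>\<alpha> | length \<alpha> = k. cmod (a \<alpha>) * scalar_word r \<alpha>) \<le> 1"
    if "sqrt (\<Sum>i\<in>UNIV. (r i)\<^sup>2) \<le> gamma_const m" for r :: "'n \<Rightarrow> real"
  proof -
    have "(\<Sum>k=0..m-1. \<Sum>\<alpha> | length \<alpha> = k. cmod (a \<alpha>) * scalar_word r \<alpha>)
        \<le> (\<Sum>k=0..m-1. gamma_const m ^ k * s k)"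
      unfolding s_def by (intro sum_mono sum_scalar_word_le that)
    with gamma_sum show ?thesis by linarith
  qed
  have v: "cmod (a []) + 2 * (\<Sum>k=1..m-1. \<Sum>\<alpha> | length \<alpha> = k. cmod (a \<alpha>) * scalar_word r \<alpha>) \<le> 1"
    if "sqrt (\<Sum>i\<in>UNIV. (r i)\<^sup>2) \<le> t_const m" for r :: "'n \<Rightarrow> real"
  proof -
    have "(\<Sum>k=1..m-1. \<Sum>\<alpha> | length \<alpha> = k. cmod (a \<alpha>) * scalar_word r \<alpha>)
        \<le> (\<Sum>k=1..m-1. t_const m ^ k * s k)"
      unfolding s_def by (intro sum_mono sum_scalar_word_le that)
    with t_sum show ?thesis by linarith
  qed
  have gamma: "0 < gamma_const p \<and> cos_poly p (gamma_const p) = 1" if "2 \<le> p" for p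
    using gamma_const[OF that] by blast
  have t: "0 < t_const p \<and> cos_poly p (t_const p) = 1 / 2" if "2 \<le> p" for p
    using t_const[OF that] by blast
  have antimono: "strict_antimono_on {2..} gamma_const" "strict_antimono_on {2..} t_const"
    by (rule cos_poly_solution_strict_antimono, erule gamma)
      (rule cos_poly_solution_strict_antimono, erule t)
  have limit: "gamma_const \<longlonglongrightarrow> 1 / 2" "t_const \<longlonglongrightarrow> 1 / 3"
    using cos_poly_solution_tendsto[OF gamma] cos_poly_solution_tendsto[OF t] by simp_all
  have ex1: "\<exists>!t. 0 < t \<and> cos_poly p t = 1" if "2 \<le> p" for p
    by (rule cos_poly_ex1[OF that]) simp
  show ?thesis
    by (intro conjI allI impI ballI)
      (erule coeff[unfolded s_def] ii iii iv v ex1 t_const_ex1 gamma_const gamma_const_le_1 t_const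
        | rule antimono limit)+
qed

end
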